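(* Let $M_\varphi$ be a hyperbolic once-punctured torus bundle with fibre $S$. If $\overline\rho\colon\pi_1(S)\to\mathrm{PSL}(2,\mathbb{C})$ is irreducible and its centraliser satisfies $|C(\mathrm{im}(\overline\rho))|=4$, then $|\overline r^{-1}(\chi_{\overline\rho})|=2^{b_1(\varphi)-1}$. Moreover, exactly one of the characters in $\overline r^{-1}(\chi_{\overline\rho})$ lifts to $X(M_\varphi)$. For each representation of $\pi_1(M_\varphi)$ with character in $\overline r^{-1}(\chi_{\overline\rho})$, the image of the longitude is trivial; the image of the meridian has order two or four if $b_1(\varphi)=2$, and has order two or is trivial if $b_1(\varphi)=3$.
   Context: $\pi_1(M_\varphi)=\langle t,a,b\mid t^{-1}at=\varphi(a),t^{-1}bt=\varphi(b)\rangle$ with $a,b$ free generators of $\pi_1(S)$, meridian $t$ and longitude $[a,b]$-type commutator $a^{-1}b^{-1}ab$. $b_1(\varphi)=\dim_{\mathbb{Z}_2}H_1(M_\varphi;\mathbb{Z}_2)$. $\overline X(N)$ is the $\mathrm{PSL}(2,\mathbb{C})$-character variety (characters $\gamma\mapsto(\operatorname{tr}\overline\rho(\gamma))^2$), $X(N)$ the $\mathrm{SL}(2,\mathbb{C})$-character variety; a character in $\overline X(M_\varphi)$ lifts to $X(M_\varphi)$ if it is the image of a point of $X(M_\varphi)$ under the map induced by $\mathrm{SL}(2,\mathbb{C})\to\mathrm{PSL}(2,\mathbb{C})$. $\overline r\colon\overline X(M_\varphi)\to\overline X(S)$ is restriction. $C(\cdot)$ denotes centraliser in $\mathrm{PSL}(2,\mathbb{C})$.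 (The centraliser has order four exactly when $\overline\rho(\pi_1(S))$ is a Klein four group, i.e. $\chi_{\overline\rho}=(0,0,0,0)$.) *)

theory Defs
  imports "HOL-Analysis.Analysis"
begin

section \<open>Words in free groups\<close>

text \<open>A letter is a pair (e, g); e = True means the inverse g^{-1}.\<close>
type_synonym 'g word = "(bool \<times> 'g) list"

definition inv_word :: "'g word \<Rightarrow> 'g word" where
  "inv_word w = rev (map (\<lambda>(e, g). (\<not> e, g)) w)"

definition free_red1 :: "'g word \<Rightarrow> 'g word \<Rightarrow> bool" where
  "free_red1 u v \<longleftrightarrow> (\<exists>xs ys e g. u = xs @ [(e, g), (\<not> e, g)] @ ys \<and> v = xs @ ys)"

text \<open>Equality of words as elements of the free group.\<close>
definition free_eq :: "'g word \<Rightarrow> 'g word \<Rightarrow> bool" where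
  "free_eq = (\<lambda>x y. free_red1 x y \<or> free_red1 y x)\<^sup>*\<^sup>*"

text \<open>Substitution endomorphism of a free group determined by images of generators.\<close>
definition subst_word :: "('g \<Rightarrow> 'h word) \<Rightarrow> 'g word \<Rightarrow> 'h word" where
  "subst_word f w = concat (map (\<lambda>(e, g). if e then inv_word (f g) else f g) w)"

section \<open>The fibre group and the bundle group\<close>

datatype sgen = SA | SB   \<comment> \<open>free generators a, b of pi_1(S)\<close>
datatype mgen = MT | MA | MB  \<comment> \<open>generators t, a, b of pi_1(M_phi)\<close>

definition sgen_to_mgen :: "sgen \<Rightarrow> mgen" where
  "sgen_to_mgen g = (case g of SA \<Rightarrow> MA | SB \<Rightarrow> MB)"

definition embed_word :: "sgen word \<Rightarrow> mgen word" where
  "embed_word w = map (\<lambda>(e, g). (e, sgen_to_mgen g)) w"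

text \<open>phi is an automorphism of the free group F(a,b).\<close>
definition is_free_aut :: "(sgen \<Rightarrow> sgen word) \<Rightarrow> bool" where
  "is_free_aut \<phi> \<longleftrightarrow> (\<exists>\<psi>. \<forall>g. free_eq (subst_word \<psi> (\<phi> g)) [(False, g)]
                                \<and> free_eq (subst_word \<phi> (\<psi> g)) [(False, g)])"

definition exp_sum :: "sgen \<Rightarrow> sgen word \<Rightarrow> int" where
  "exp_sum g w = (\<Sum>l\<leftarrow>w. if snd l = g then (if fst l then -1 else 1) else 0)"

text \<open>Action of phi on H_1(S;Z) = Z^2: matrix entries.\<close>
definition ab_tr :: "(sgen \<Rightarrow> sgen word) \<Rightarrow> int" where
  "ab_tr \<phi> = exp_sum SA (\<phi> SA) + exp_sum SB (\<phi> SB)"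

definition ab_det :: "(sgen \<Rightarrow> sgen word) \<Rightarrow> int" where
  "ab_det \<phi> = exp_sum SA (\<phi> SA) * exp_sum SB (\<phi> SB) - exp_sum SA (\<phi> SB) * exp_sum SB (\<phi> SA)"

text \<open>M_phi is a hyperbolic (orientable) once-punctured torus bundle:
  phi is an automorphism of pi_1(S) = F(a,b) (every such is induced by a homeomorphism
  of S), orientation preserving, and Anosov (|trace| > 2).\<close>
definition hyperbolic_optb :: "(sgen \<Rightarrow> sgen word) \<Rightarrow> bool" where
  "hyperbolic_optb \<phi> \<longleftrightarrow> is_free_aut \<phi> \<and> ab_det \<phi> = 1 \<and> \<bar>ab_tr \<phi>\<bar> > 2"

text \<open>The relator words t^{-1} g t and the image phi(g) inside pi_1(M_phi).\<close>
definition conj_t :: "sgen \<Rightarrow> mgen word" where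
  "conj_t g = [(True, MT), (False, sgen_to_mgen g), (False, MT)]"

definition longitude :: "mgen word" where
  "longitude = [(True, MA), (True, MB), (False, MA), (False, MB)]"

section \<open>Matrices, SL(2,C), PSL(2,C)\<close>

type_synonym cmat = "complex^2^2"

definition mat_eval :: "('g \<Rightarrow> cmat) \<Rightarrow> 'g word \<Rightarrow> cmat" where
  "mat_eval \<rho> w = foldr (\<lambda>(e, g) M. (if e then matrix_inv (\<rho> g) else \<rho> g) ** M) w (mat 1)"

text \<open>Equality in PSL(2,C) of two SL(2,C) representatives.\<close>
definition psl_eq :: "cmat \<Rightarrow> cmat \<Rightarrow> bool" where
  "psl_eq M N \<longleftrightarrow> M = N \<or> M = - N"

text \<open>Order of the image of M in PSL(2,C) (0 if infinite order).\<close>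
definition psl_order :: "cmat \<Rightarrow> nat" where
  "psl_order M = (if \<exists>n>0. psl_eq ((((**) M) ^^ n) (mat 1)) (mat 1)
                  then LEAST n. n > 0 \<and> psl_eq ((((**) M) ^^ n) (mat 1)) (mat 1) else 0)"

text \<open>Representations: a homomorphism to PSL(2,C) from a group with the given generators
  is described by choosing SL(2,C) lifts of the images of the generators; the relations then
  hold up to sign.  Characters (trace squared) do not depend on the choice of lifts.\<close>
definition psl_rep_M :: "(sgen \<Rightarrow> sgen word) \<Rightarrow> (mgen \<Rightarrow> cmat) \<Rightarrow> bool" where
  "psl_rep_M \<phi> \<rho> \<longleftrightarrow> (\<forall>g. det (\<rho> g) = 1) \<and>
     (\<forall>g. psl_eq (mat_eval \<rho> (conj_t g)) (mat_eval \<rho> (embed_word (\<phi> g))))"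

definition sl_rep_M :: "(sgen \<Rightarrow> sgen word) \<Rightarrow> (mgen \<Rightarrow> cmat) \<Rightarrow> bool" where
  "sl_rep_M \<phi> \<rho> \<longleftrightarrow> (\<forall>g. det (\<rho> g) = 1) \<and>
     (\<forall>g. mat_eval \<rho> (conj_t g) = mat_eval \<rho> (embed_word (\<phi> g)))"

definition psl_rep_S :: "(sgen \<Rightarrow> cmat) \<Rightarrow> bool" where
  "psl_rep_S \<sigma> \<longleftrightarrow> (\<forall>g. det (\<sigma> g) = 1)"

text \<open>PSL character: gamma |-> (tr rho(gamma))^2; SL character: gamma |-> tr rho(gamma).\<close>
definition pchar :: "('g \<Rightarrow> cmat) \<Rightarrow> 'g word \<Rightarrow> complex" where
  "pchar \<rho> = (\<lambda>w. (trace (mat_eval \<rho> w))\<^sup>2)"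

definition schar :: "('g \<Rightarrow> cmat) \<Rightarrow> 'g word \<Rightarrow> complex" where
  "schar \<rho> = (\<lambda>w. trace (mat_eval \<rho> w))"

text \<open>PSL(2,C)-character variety of M_phi (as the set of characters).\<close>
definition Xbar_M :: "(sgen \<Rightarrow> sgen word) \<Rightarrow> (mgen word \<Rightarrow> complex) set" where
  "Xbar_M \<phi> = {pchar \<rho> | \<rho>. psl_rep_M \<phi> \<rho>}"

definition X_M :: "(sgen \<Rightarrow> sgen word) \<Rightarrow> (mgen word \<Rightarrow> complex) set" where
  "X_M \<phi> = {schar \<rho> | \<rho>. sl_rep_M \<phi> \<rho>}"

text \<open>The map X(M) -> Xbar(M) induced by SL(2,C) -> PSL(2,C) squares the traces.\<close>
definition lifts_to_X :: "(sgen \<Rightarrow> sgen word) \<Rightarrow> (mgen word \<Rightarrow> complex) \<Rightarrow> bool" where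
  "lifts_to_X \<phi> chi \<longleftrightarrow> (\<exists>xi\<in>X_M \<phi>. chi = (\<lambda>w. (xi w)\<^sup>2))"

text \<open>Restriction map rbar : Xbar(M_phi) -> Xbar(S).\<close>
definition rbar :: "(mgen word \<Rightarrow> complex) \<Rightarrow> sgen word \<Rightarrow> complex" where
  "rbar chi = (\<lambda>w. chi (embed_word w))"

definition rbar_fibre :: "(sgen \<Rightarrow> sgen word) \<Rightarrow> (sgen word \<Rightarrow> complex) \<Rightarrow> (mgen word \<Rightarrow> complex) set" where
  "rbar_fibre \<phi> chi0 = {chi \<in> Xbar_M \<phi>. rbar chi = chi0}"

text \<open>Image of a representation of pi_1(S) (SL(2,C) representatives).\<close>
definition rep_image :: "('g \<Rightarrow> cmat) \<Rightarrow> cmat set" where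
  "rep_image \<rho> = range (mat_eval \<rho>)"

text \<open>Irreducible: no common invariant line in C^2.\<close>
definition irreducible_rep :: "('g \<Rightarrow> cmat) \<Rightarrow> bool" where
  "irreducible_rep \<rho> \<longleftrightarrow> \<not> (\<exists>v::complex^2. v \<noteq> 0 \<and> (\<forall>M\<in>rep_image \<rho>. \<exists>c. M *v v = c *s v))"

text \<open>Centraliser in PSL(2,C) of a set of elements (given by SL representatives);
  an element of PSL(2,C) is represented as the set {X, -X}.\<close>
definition psl_centraliser :: "cmat set \<Rightarrow> cmat set set" where
  "psl_centraliser S = {{X, - X} | X. det X = 1 \<and>
       (\<forall>M\<in>S. psl_eq (X ** M ** matrix_inv X) M)}"

section \<open>Mod 2 first Betti number\<close>

text \<open>Homomorphisms pi_1(M_phi) -> Z/2 (Z/2 as bool with xor), described by images of generators.\<close>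
definition z2_eval :: "('g \<Rightarrow> bool) \<Rightarrow> 'g word \<Rightarrow> bool" where
  "z2_eval h w = foldr (\<lambda>(e, g) b. h g \<noteq> b) w False"

definition z2_homs_M :: "(sgen \<Rightarrow> sgen word) \<Rightarrow> (mgen \<Rightarrow> bool) set" where
  "z2_homs_M \<phi> = {h. \<forall>g. z2_eval h (conj_t g) = z2_eval h (embed_word (\<phi> g))}"

text \<open>b_1(phi) = dim_{Z/2} H_1(M_phi; Z/2) = dim_{Z/2} Hom(pi_1(M_phi), Z/2).\<close>
definition b1 :: "(sgen \<Rightarrow> sgen word) \<Rightarrow> nat" where
  "b1 \<phi> = (THE n. card (z2_homs_M \<phi>) = 2 ^ n)"

end

(* Proof idea.  A centraliser of order four contains, modulo sign, elements conjugating
   a \<mapsto> -a, b \<mapsto> b and a \<mapsto> a, b \<mapsto> -b; by Schur's lemma this forces tr a = tr b = tr ab = 0,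
   and such a pair is conjugate to the quaternions (I, J).  So up to conjugacy every
   representation in the fibre sends a, b to I, J and t to some T with T\<^sup>-\<^sup>1 I T = \<plusminus>\<phi>(a)(I, J) and
   T\<^sup>-\<^sup>1 J T = \<plusminus>\<phi>(b)(I, J).  Modulo sign the right hand sides depend only on the action of \<phi> on
   H_1(S; Z/2), and Schur's lemma again gives, for each of the four choices of signs, exactly one
   solution \<plusminus>T; exactly one choice of signs is the honest SL(2,C) relation, and the longitude
   goes to [I, J] = -1.  The action on H_1(S; Z/2) is one of the six elements of GL(2, Z/2); in
   each case explicit unit quaternions solve the equations, conjugation by I or J identifies
   their characters in pairs as predicted by b_1, and the orders of the quaternions are read
   off. *)

theory Submission
  imports Defs
begin

section \<open>Two-by-two matrices in coordinates\<close>

definition mat2 :: "'a \<Rightarrow> 'a \<Rightarrow> 'a \<Rightarrow> 'a \<Rightarrow> 'a^2^2" where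
  "mat2 a b c d = (\<chi> i j. if i = 1 then (if j = 1 then a else b) else (if j = 1 then c else d))"

lemma mat2_nth [simp]:
  "mat2 a b c d $ 1 $ 1 = a" "mat2 a b c d $ 1 $ 2 = b"
  "mat2 a b c d $ 2 $ 1 = c" "mat2 a b c d $ 2 $ 2 = d"
  by (simp_all add: mat2_def)

lemma mat2_cases: obtains a b c d where "M = mat2 a b c d"
proof
  show "M = mat2 (M$1$1) (M$1$2) (M$2$1) (M$2$2)" by (simp add: vec_eq_iff forall_2)
qed

lemma mat2_eq_iff [simp]:
  "mat2 a b c d = mat2 a' b' c' d' \<longleftrightarrow> a = a' \<and> b = b' \<and> c = c' \<and> d = d'"
  by (auto simp: vec_eq_iff forall_2)

lemma mat2_mult [simp]:
  fixes a b c d e f g h :: "'a::semiring_1"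
  shows "mat2 a b c d ** mat2 e f g h = mat2 (a*e + b*g) (a*f + b*h) (c*e + d*g) (c*f + d*h)"
  by (simp add: vec_eq_iff forall_2 matrix_matrix_mult_def sum_2)

lemma det_mat2 [simp]: "det (mat2 a b c d) = a*d - b*(c::'a::comm_ring_1)"
  by (simp add: det_2)

lemma trace_mat2 [simp]: "trace (mat2 a b c d) = a + (d::'a::comm_semiring_1)"
  by (simp add: trace_def sum_2)

lemma mat1_eq_mat2: "mat 1 = mat2 1 0 0 (1::'a::zero_neq_one)"
  by (simp add: vec_eq_iff forall_2 mat_def)

lemma uminus_mat2 [simp]: "- mat2 a b c d = mat2 (-a) (-b) (-c) (-d::'a::uminus)"
  by (simp add: vec_eq_iff forall_2)

lemma uminus_matrix_mult [simp]:
  fixes A B :: "'a::ring_1^2^2"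
  shows "(- A) ** B = - (A ** B)" "A ** (- B) = - (A ** B)"
  by (cases A rule: mat2_cases; cases B rule: mat2_cases; simp)+

lemma trace_uminus: "trace (- M) = - trace (M::'a::comm_ring_1^2^2)"
  by (cases M rule: mat2_cases) simp

lemma det_uminus: "det (- M) = det (M::'a::comm_ring_1^2^2)"
  by (cases M rule: mat2_cases) simp

lemma matrix_inv_unique:
  fixes A B :: "'a::semiring_1^'n^'n"
  assumes "A ** B = mat 1" "B ** A = mat 1"
  shows "matrix_inv A = B"
proof -
  have "A ** matrix_inv A = mat 1 \<and> matrix_inv A ** A = mat 1"
    unfolding matrix_inv_def by (rule someI[of _ B]) (use assms in blast)
  then have "matrix_inv A = (B ** A) ** matrix_inv A"
    by (simp add: assms)
  also have "\<dots> = B" using \<open>A ** matrix_inv A = mat 1 \<and> _\<close>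
    by (simp flip: matrix_mul_assoc)
  finally show ?thesis .
qed

lemma matrix_inv_mat2 [simp]:
  "a*d - b*c = 1 \<Longrightarrow> matrix_inv (mat2 a b c d) = mat2 d (-b) (-c) (a::'a::comm_ring_1)"
  by (rule matrix_inv_unique) (simp_all add: mat1_eq_mat2 algebra_simps)

context
  fixes M :: "'a::comm_ring_1^2^2"
  assumes det_M: "det M = 1"
begin

lemma matrix_mul_inv_det1: "M ** matrix_inv M = mat 1" "matrix_inv M ** M = mat 1"
  using det_M by (cases M rule: mat2_cases; simp add: mat1_eq_mat2 algebra_simps)+

lemma det_matrix_inv_det1: "det (matrix_inv M) = 1"
  using det_M by (cases M rule: mat2_cases) (simp add: algebra_simps)

lemma matrix_inv_inv_det1: "matrix_inv (matrix_inv M) = M"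
  by (rule matrix_inv_unique) (simp_all add: matrix_mul_inv_det1)

lemma matrix_inv_uminus_det1: "matrix_inv (- M) = - matrix_inv M"
  using det_M by (cases M rule: mat2_cases) simp

lemma matrix_inv_mult_cancel_left:
  "matrix_inv M ** (M ** A) = A" "M ** (matrix_inv M ** A) = A"
  by (simp_all add: matrix_mul_assoc matrix_mul_inv_det1)

end

lemma trace_conj:
  fixes M P Q :: "'a::comm_semiring_1^'n^'n"
  assumes "Q ** P = mat 1"
  shows "trace (P ** M ** Q) = trace M"
  by (metis assms matrix_mul_assoc matrix_mul_lid trace_mul_sym)

lemma det_conj:
  fixes M P Q :: "'a::comm_ring_1^'n^'n"
  assumes "P ** Q = mat 1"
  shows "det (P ** M ** Q) = det M"
proof -
  have "det P * det Q = 1" using det_mul[of P Q] assms by simp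
  then show ?thesis by (simp add: det_mul algebra_simps)
qed

lemma matrix_mul_conj_conj:
  fixes M P Q :: "'a::semiring_1^'n^'n"
  assumes "Q ** P = mat 1"
  shows "Q ** (P ** M ** Q) ** P = M"
  by (simp add: assms matrix_mul_assoc) (simp add: assms flip: matrix_mul_assoc)

section \<open>Evaluating words\<close>

lemma mat_eval_Nil [simp]: "mat_eval \<rho> [] = mat 1"
  by (simp add: mat_eval_def)

lemma mat_eval_Cons [simp]:
  "mat_eval \<rho> ((e, g) # w) = (if e then matrix_inv (\<rho> g) else \<rho> g) ** mat_eval \<rho> w"
  by (simp add: mat_eval_def)

lemma mat_eval_embed_word: "mat_eval \<rho> (embed_word w) = mat_eval (\<rho> \<circ> sgen_to_mgen) w"
  by (induction w) (auto simp: embed_word_def)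

lemma matrix_inv_conj:
  fixes M P Q :: "'a::comm_ring_1^2^2"
  assumes "P ** Q = mat 1" "Q ** P = mat 1" "det M = 1"
  shows "matrix_inv (P ** M ** Q) = P ** matrix_inv M ** Q"
proof (rule matrix_inv_unique)
  have c: "P ** A ** Q ** (P ** B ** Q) = P ** (A ** B) ** Q" for A B
    by (metis assms(2) matrix_mul_assoc matrix_mul_rid)
  show "P ** M ** Q ** (P ** matrix_inv M ** Q) = mat 1"
    "P ** matrix_inv M ** Q ** (P ** M ** Q) = mat 1"
    by (simp_all only: c matrix_mul_inv_det1[OF assms(3)] matrix_mul_rid assms(1))
qed

lemma mat_eval_conj:
  fixes P Q :: cmat
  assumes "P ** Q = mat 1" "Q ** P = mat 1" "\<And>g. det (\<rho> g) = 1"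
  shows "mat_eval (\<lambda>g. P ** \<rho> g ** Q) w = P ** mat_eval \<rho> w ** Q"
proof (induction w)
  case Nil then show ?case using assms by simp
next
  case (Cons l w)
  obtain e g where l: "l = (e, g)" by (cases l)
  have "(if e then matrix_inv (P ** \<rho> g ** Q) else P ** \<rho> g ** Q)
      = P ** (if e then matrix_inv (\<rho> g) else \<rho> g) ** Q"
    using matrix_inv_conj assms by auto
  then show ?case using Cons l
    by (simp add: matrix_mul_assoc) (simp add: assms flip: matrix_mul_assoc)
qed

section \<open>Equality in PSL(2,C)\<close>

lemma psl_eq_refl [simp]: "psl_eq M M"
  by (simp add: psl_eq_def)

lemma psl_eq_sym: "psl_eq M N \<Longrightarrow> psl_eq N M"
  by (auto simp: psl_eq_def)

lemma psl_eq_trans [trans]: "psl_eq L M \<Longrightarrow> psl_eq M N \<Longrightarrow> psl_eq L N"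
  by (auto simp: psl_eq_def)

lemma psl_eq_mult: "psl_eq A A' \<Longrightarrow> psl_eq B B' \<Longrightarrow> psl_eq (A ** B) (A' ** B')"
  by (auto simp: psl_eq_def)

lemma psl_eq_conj: "psl_eq M N \<Longrightarrow> psl_eq (P ** M ** Q) (P ** N ** Q)"
  by (auto simp: psl_eq_def)

lemma trace_sq_psl_eq: "psl_eq M N \<Longrightarrow> (trace M)\<^sup>2 = (trace N)\<^sup>2"
  by (auto simp: psl_eq_def trace_uminus)

lemma psl_eq_mat_eval_sign_change:
  assumes "\<And>g. \<rho>' g = \<rho> g \<or> \<rho>' g = - \<rho> g" "\<And>g. det (\<rho> g) = 1"
  shows "psl_eq (mat_eval \<rho>' w) (mat_eval \<rho> w)"
proof (induction w)
  case (Cons l w)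
  obtain e g where l: "l = (e, g)" by (cases l)
  have "psl_eq (\<rho>' g) (\<rho> g)"
    using assms(1)[of g] by (auto simp: psl_eq_def)
  then have "psl_eq (if e then matrix_inv (\<rho>' g) else \<rho>' g) (if e then matrix_inv (\<rho> g) else \<rho> g)"
    using matrix_inv_uminus_det1[OF assms(2)[of g]] by (auto simp: psl_eq_def)
  then show ?case using Cons l psl_eq_mult by simp
qed simp

lemma pchar_conj:
  fixes P Q :: cmat
  assumes "P ** Q = mat 1" "Q ** P = mat 1" "\<And>g. det (\<rho> g) = 1"
  shows "pchar (\<lambda>g. P ** \<rho> g ** Q) = pchar \<rho>"
  by (rule ext) (simp add: pchar_def mat_eval_conj[OF assms] trace_conj[OF assms(2)])

lemma pchar_sign_change:
  assumes "\<And>g. \<rho>' g = \<rho> g \<or> \<rho>' g = - \<rho> g" "\<And>g. det (\<rho> g) = 1"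
  shows "pchar \<rho>' = pchar \<rho>"
  by (rule ext) (simp add: pchar_def trace_sq_psl_eq[OF psl_eq_mat_eval_sign_change[OF assms]])

section \<open>Quaternions as complex matrices\<close>

definition quat :: "complex \<Rightarrow> complex \<Rightarrow> complex \<Rightarrow> complex \<Rightarrow> cmat" where
  "quat x0 x1 x2 x3 = mat2 (x0 + \<i> * x1) (x2 + \<i> * x3) (- x2 + \<i> * x3) (x0 - \<i> * x1)"

abbreviation "qI \<equiv> quat 0 1 0 0"
abbreviation "qJ \<equiv> quat 0 0 1 0"
abbreviation "qK \<equiv> quat 0 0 0 1"

lemma quat_mult [simp]:
  "quat a0 a1 a2 a3 ** quat c0 c1 c2 c3 =
   quat (a0 * c0 - a1 * c1 - a2 * c2 - a3 * c3) (a0 * c1 + a1 * c0 + a2 * c3 - a3 * c2)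
        (a0 * c2 - a1 * c3 + a2 * c0 + a3 * c1) (a0 * c3 + a1 * c2 - a2 * c1 + a3 * c0)"
  unfolding quat_def mat2_mult mat2_eq_iff
  by (intro conjI) (simp_all add: algebra_simps)

lemma quat_eq_iff [simp]:
  "quat a0 a1 a2 a3 = quat c0 c1 c2 c3 \<longleftrightarrow> a0 = c0 \<and> a1 = c1 \<and> a2 = c2 \<and> a3 = c3"
proof
  assume "quat a0 a1 a2 a3 = quat c0 c1 c2 c3"
  then have e: "a0 + \<i> * a1 = c0 + \<i> * c1" "a0 - \<i> * a1 = c0 - \<i> * c1"
    "a2 + \<i> * a3 = c2 + \<i> * c3" "- a2 + \<i> * a3 = - c2 + \<i> * c3"
    by (simp_all add: quat_def)
  have "a0 = c0" "\<i> * a1 = \<i> * c1" using e(1,2) by algebra+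
  moreover have "a2 = c2" "\<i> * a3 = \<i> * c3" using e(3,4) by algebra+
  ultimately show "a0 = c0 \<and> a1 = c1 \<and> a2 = c2 \<and> a3 = c3" by simp
qed simp

lemma det_quat [simp]: "det (quat x0 x1 x2 x3) = x0 * x0 + x1 * x1 + x2 * x2 + x3 * x3"
  by (simp add: quat_def algebra_simps)

lemma trace_quat [simp]: "trace (quat x0 x1 x2 x3) = 2 * x0"
  by (simp add: quat_def)

lemma uminus_quat [simp]: "- quat x0 x1 x2 x3 = quat (- x0) (- x1) (- x2) (- x3)"
  by (simp add: quat_def)

lemma mat1_eq_quat: "mat 1 = quat 1 0 0 0"
  by (simp add: quat_def mat1_eq_mat2)

lemma matrix_inv_quat [simp]:
  "x0 * x0 + x1 * x1 + x2 * x2 + x3 * x3 = 1 \<Longrightarrow>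
   matrix_inv (quat x0 x1 x2 x3) = quat x0 (- x1) (- x2) (- x3)"
  by (rule matrix_inv_unique) (simp_all add: mat1_eq_quat algebra_simps)

text \<open>Modulo sign, \<open>q8_rep\<close> takes values in the Klein four group \<open>{1, I, J, K}\<close>, so a word
  evaluates according to the parities of its exponent sums.\<close>

definition q8_rep :: "sgen \<Rightarrow> cmat" where
  "q8_rep g = (case g of SA \<Rightarrow> qI | SB \<Rightarrow> qJ)"

definition q8 :: "bool \<Rightarrow> bool \<Rightarrow> cmat" where
  "q8 \<alpha> \<beta> = (if \<alpha> then (if \<beta> then qK else qI) else (if \<beta> then qJ else mat 1))"

lemma q8_rep_simps [simp]: "q8_rep SA = qI" "q8_rep SB = qJ"
  by (simp_all add: q8_rep_def)

lemma exp_sum_Nil [simp]: "exp_sum g [] = 0"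
  by (simp add: exp_sum_def)

lemma exp_sum_Cons [simp]:
  "exp_sum g ((e, h) # w) = (if h = g then (if e then -1 else 1) else 0) + exp_sum g w"
  by (simp add: exp_sum_def)

lemma psl_eq_q8_rep_letter:
  "psl_eq ((if e then matrix_inv (q8_rep g) else q8_rep g) ** q8 \<alpha> \<beta>)
          (q8 (if g = SA then \<not> \<alpha> else \<alpha>) (if g = SB then \<not> \<beta> else \<beta>))"
  by (cases e; cases g; cases \<alpha>; cases \<beta>) (simp_all add: q8_def psl_eq_def mat1_eq_quat)

lemma psl_eq_mat_eval_q8_rep:
  "psl_eq (mat_eval q8_rep w) (q8 (odd (exp_sum SA w)) (odd (exp_sum SB w)))"
proof (induction w)
  case (Cons l w)
  obtain e g where l: "l = (e, g)" by (cases l)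
  define \<alpha> \<beta> where "\<alpha> = odd (exp_sum SA w)" and "\<beta> = odd (exp_sum SB w)"
  have "psl_eq (mat_eval q8_rep (l # w)) ((if e then matrix_inv (q8_rep g) else q8_rep g) ** q8 \<alpha> \<beta>)"
    using l Cons psl_eq_mult[OF psl_eq_refl] by (simp add: \<alpha>_def \<beta>_def)
  also have "psl_eq \<dots> (q8 (if g = SA then \<not> \<alpha> else \<alpha>) (if g = SB then \<not> \<beta> else \<beta>))"
    by (rule psl_eq_q8_rep_letter)
  also have "q8 (if g = SA then \<not> \<alpha> else \<alpha>) (if g = SB then \<not> \<beta> else \<beta>)
      = q8 (odd (exp_sum SA (l # w))) (odd (exp_sum SB (l # w)))"
    using l by (cases g) (simp_all add: \<alpha>_def \<beta>_def)
  finally show ?case .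
qed (simp add: q8_def)

section \<open>Schur's lemma\<close>

definition vec2 :: "'a \<Rightarrow> 'a \<Rightarrow> 'a^2" where
  "vec2 x y = (\<chi> i. if i = 1 then x else y)"

lemma vec2_eq_iff [simp]: "vec2 x y = vec2 x' y' \<longleftrightarrow> x = x' \<and> y = y'"
  by (auto simp: vec2_def vec_eq_iff forall_2)

lemma vec2_eq_0_iff: "vec2 x y = 0 \<longleftrightarrow> x = 0 \<and> y = (0::'a::zero)"
  by (auto simp: vec2_def vec_eq_iff forall_2)

lemma vec2_cases: obtains x y where "v = vec2 x y"
proof
  show "v = vec2 (v$1) (v$2)" by (simp add: vec2_def vec_eq_iff forall_2)
qed

lemma mat2_mult_vec2 [simp]:
  "mat2 a b c d *v vec2 x y = vec2 (a * x + b * y) (c * x + d * (y::'a::semiring_1))"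
  by (simp add: vec2_def vec_eq_iff forall_2 matrix_vector_mult_def sum_2)

lemma scale_vec2 [simp]: "k *s vec2 x y = vec2 (k * x) (k * (y::'a::times))"
  by (simp add: vec2_def vec_eq_iff forall_2)

lemma exists_eigenvector:
  fixes Z :: cmat
  obtains l v where "v \<noteq> 0" "Z *v v = l *s v"
proof -
  obtain p q r s where Z: "Z = mat2 p q r s" by (rule mat2_cases)
  show ?thesis
  proof (cases "q = 0")
    case True
    then show ?thesis using Z by (intro that[of "vec2 0 1" s]) (simp_all add: vec2_eq_0_iff)
  next
    case False
    define C where "C = csqrt ((p + s)\<^sup>2 - 4 * (p * s - q * r))"
    define l where "l = (p + s + C) / 2"
    have "C\<^sup>2 = (p + s)\<^sup>2 - 4 * (p * s - q * r)" "2 * l = p + s + C"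
      by (simp_all add: C_def l_def)
    then have "l * l - (p + s) * l + (p * s - q * r) = 0"
      by algebra
    then show ?thesis using Z False
      by (intro that[of "vec2 q (l - p)" l]) (simp_all add: vec2_eq_0_iff algebra_simps)
  qed
qed

lemma commuting_matrix_affine:
  fixes Z M :: cmat
  assumes "Z ** M = M ** Z" "\<nexists>z. Z = mat2 z 0 0 z"
  shows "\<exists>\<alpha> \<beta>. M = mat2 (\<alpha> + \<beta> * Z$1$1) (\<beta> * Z$1$2) (\<beta> * Z$2$1) (\<alpha> + \<beta> * Z$2$2)"
proof -
  obtain p q r s where Z: "Z = mat2 p q r s" by (rule mat2_cases)
  obtain m1 m2 m3 m4 where M: "M = mat2 m1 m2 m3 m4" by (rule mat2_cases)
  have e: "p * m1 + q * m3 = m1 * p + m2 * r" "p * m2 + q * m4 = m1 * q + m2 * s"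
          "r * m1 + s * m3 = m3 * p + m4 * r"
    using assms(1) unfolding Z M by simp_all
  consider "q \<noteq> 0" | "q = 0" "r \<noteq> 0" | "q = 0" "r = 0" "p \<noteq> s"
    using assms(2) Z by auto
  then have "\<exists>\<beta>. m2 = \<beta> * q \<and> m3 = \<beta> * r \<and> m4 - m1 = \<beta> * (s - p)"
  proof cases
    case 1
    then show ?thesis using e(1,2)
      by (intro exI[of _ "m2 / q"]) (auto simp: field_simps)
  next
    case 2
    then show ?thesis using e(1,3)
      by (intro exI[of _ "m3 / r"]) (auto simp: field_simps)
  next
    case 3
    then show ?thesis using e(2,3)
      by (intro exI[of _ "(m4 - m1) / (s - p)"]) (auto simp: field_simps)
  qed
  then obtain \<beta> where "m2 = \<beta> * q" "m3 = \<beta> * r" "m4 - m1 = \<beta> * (s - p)" by blast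
  then show ?thesis unfolding Z M
    by (intro exI[of _ "m1 - \<beta> * p"] exI[of _ \<beta>]) (simp add: algebra_simps)
qed

lemma eigenvector_matrix_inv:
  fixes M :: cmat
  assumes "det M = 1" "M *v v = c *s v" "v \<noteq> 0"
  shows "matrix_inv M *v v = inverse c *s v"
proof -
  have "v = matrix_inv M *v (M *v v)"
    by (simp add: matrix_vector_mul_assoc matrix_mul_inv_det1 assms(1))
  also have "\<dots> = c *s (matrix_inv M *v v)"
    by (simp add: assms(2) vec.scale)
  finally have v: "v = c *s (matrix_inv M *v v)" .
  with assms(3) have "c \<noteq> 0" by auto
  from arg_cong[OF v, of "(*s) (inverse c)"] show ?thesis
    using \<open>c \<noteq> 0\<close> by (simp add: vector_smult_assoc)
qed

lemma common_eigenvector_mat_eval: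
  assumes "\<And>g. det (\<sigma> g) = 1" "\<And>g. \<exists>c. \<sigma> g *v v = c *s v" "v \<noteq> 0"
  shows "\<exists>c. mat_eval \<sigma> w *v v = c *s v"
proof (induction w)
  case Nil
  then show ?case by (intro exI[of _ 1]) simp
next
  case (Cons l w)
  obtain e g where l: "l = (e, g)" by (cases l)
  obtain c where c: "mat_eval \<sigma> w *v v = c *s v" using Cons by blast
  obtain d where d: "\<sigma> g *v v = d *s v" using assms(2) by blast
  have "(if e then matrix_inv (\<sigma> g) else \<sigma> g) *v v = (if e then inverse d else d) *s v"
    using eigenvector_matrix_inv[OF assms(1) d assms(3)] d by simp
  then have "mat_eval \<sigma> (l # w) *v v = ((if e then inverse d else d) * c) *s v"
    using l c by (simp flip: matrix_vector_mul_assoc add: vec.scale vector_smult_assoc mult.commute)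
  then show ?case by blast
qed

text \<open>An eigenvector of a non-scalar \<open>Z\<close> is an eigenvector of every matrix commuting with
  \<open>Z\<close> (\<open>commuting_matrix_affine\<close>), hence a common eigenvector of the whole image.\<close>

lemma scalar_if_commutes_with_irreducible:
  fixes Z :: cmat
  assumes "irreducible_rep \<sigma>" "\<And>g. det (\<sigma> g) = 1" "\<And>g. Z ** \<sigma> g = \<sigma> g ** Z"
  shows "\<exists>z. Z = mat2 z 0 0 z"
proof (rule ccontr)
  assume non_scalar: "\<nexists>z. Z = mat2 z 0 0 z"
  obtain l v where v: "v \<noteq> 0" "Z *v v = l *s v" by (rule exists_eigenvector)
  have "\<exists>c. \<sigma> g *v v = c *s v" for g
  proof -
    obtain p q r s where Z: "Z = mat2 p q r s" by (rule mat2_cases)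
    obtain x y where xy: "v = vec2 x y" by (rule vec2_cases)
    obtain \<alpha> \<beta> where "\<sigma> g = mat2 (\<alpha> + \<beta> * p) (\<beta> * q) (\<beta> * r) (\<alpha> + \<beta> * s)"
      using commuting_matrix_affine[OF assms(3)[of g] non_scalar] Z by auto
    moreover have "p * x + q * y = l * x" "r * x + s * y = l * y"
      using v(2) Z xy by simp_all
    ultimately have "\<sigma> g *v v = (\<alpha> + \<beta> * l) *s v"
      using xy by (simp add: algebra_simps) (metis distrib_left mult.assoc)
    then show ?thesis by blast
  qed
  then have "\<exists>c. mat_eval \<sigma> w *v v = c *s v" for w
    by (rule common_eigenvector_mat_eval[OF assms(2) _ v(1)])
  then show False
    using assms(1) v(1) unfolding irreducible_rep_def rep_image_def by blast
qed

section \<open>Consequences of a centraliser of order four\<close>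

lemma conj_mult:
  fixes X A B :: "'a::comm_ring_1^2^2"
  assumes "det X = 1"
  shows "X ** (A ** B) ** matrix_inv X = (X ** A ** matrix_inv X) ** (X ** B ** matrix_inv X)"
  by (simp add: matrix_mul_inv_det1[OF assms] matrix_inv_mult_cancel_left[OF assms]
      flip: matrix_mul_assoc)

lemma commute_if_conj_eq:
  fixes X Y M :: "'a::comm_ring_1^2^2"
  assumes "det X = 1" "det Y = 1" "X ** M ** matrix_inv X = Y ** M ** matrix_inv Y"
  shows "(matrix_inv Y ** X) ** M = M ** (matrix_inv Y ** X)"
proof -
  have "(matrix_inv Y ** X) ** M = matrix_inv Y ** (X ** M ** matrix_inv X) ** X"
    by (simp add: matrix_mul_inv_det1[OF assms(1)] flip: matrix_mul_assoc)
  also have "\<dots> = matrix_inv Y ** (Y ** M ** matrix_inv Y) ** X"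
    by (simp only: assms(3))
  also have "\<dots> = M ** (matrix_inv Y ** X)"
    by (simp add: matrix_inv_mult_cancel_left[OF assms(2)] flip: matrix_mul_assoc)
  finally show ?thesis .
qed

lemma eq_or_uminus_if_conj_eq:
  fixes X Y :: cmat
  assumes "irreducible_rep \<sigma>" "\<And>g. det (\<sigma> g) = 1" "det X = 1" "det Y = 1"
    and "\<And>g. X ** \<sigma> g ** matrix_inv X = Y ** \<sigma> g ** matrix_inv Y"
  shows "X = Y \<or> X = - Y"
proof -
  obtain z where z: "matrix_inv Y ** X = mat2 z 0 0 z"
    using scalar_if_commutes_with_irreducible[OF assms(1,2) commute_if_conj_eq[OF assms(3,4,5)]]
    by blast
  have "z * z = 1"
    using arg_cong[OF z, of det] by (simp add: det_mul det_matrix_inv_det1 assms(3,4))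
  then have "z = 1 \<or> z = -1"
    by (metis mult_cancel_left1 square_eq_1_iff)
  moreover have "X = Y ** mat2 z 0 0 z"
    by (simp flip: z add: matrix_mul_assoc matrix_mul_inv_det1[OF assms(4)])
  ultimately show ?thesis
    by (cases Y rule: mat2_cases) auto
qed

lemma psl_centraliser_generatorsE:
  assumes "S \<in> psl_centraliser (rep_image \<sigma>)"
  obtains X where "S = {X, - X}" "det X = 1" "\<And>g. psl_eq (X ** \<sigma> g ** matrix_inv X) (\<sigma> g)"
proof -
  have "\<sigma> g \<in> rep_image \<sigma>" for g
    using rangeI[of "mat_eval \<sigma>" "[(False, g)]"] by (simp add: rep_image_def)
  then show ?thesis
    using assms that unfolding psl_centraliser_def by blast
qed

definition conj_flips :: "(sgen \<Rightarrow> cmat) \<Rightarrow> cmat \<Rightarrow> bool \<times> bool" where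
  "conj_flips \<sigma> X = (X ** \<sigma> SA ** matrix_inv X \<noteq> \<sigma> SA, X ** \<sigma> SB ** matrix_inv X \<noteq> \<sigma> SB)"

lemma conj_flips_some:
  assumes "S = {X, - X}" "det X = 1"
  shows "conj_flips \<sigma> (SOME X. X \<in> S) = conj_flips \<sigma> X"
proof -
  have "(SOME X. X \<in> S) \<in> S"
    using assms(1) by (metis insertI1 someI)
  then show ?thesis
    using assms by (auto simp: conj_flips_def matrix_inv_uminus_det1)
qed

text \<open>An element of the centraliser conjugates each generator to itself or to its negative.
  By Schur's lemma this sign pattern determines the element, so a centraliser of order four
  realises all four patterns.\<close>

lemma inj_on_conj_flips_psl_centraliser:
  assumes "irreducible_rep \<sigma>" "psl_rep_S \<sigma>"
  shows "inj_on (\<lambda>S. conj_flips \<sigma> (SOME X. X \<in> S)) (psl_centraliser (rep_image \<sigma>))"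
proof (rule inj_onI)
  fix S1 S2
  assume S: "S1 \<in> psl_centraliser (rep_image \<sigma>)" "S2 \<in> psl_centraliser (rep_image \<sigma>)"
    and eq: "conj_flips \<sigma> (SOME X. X \<in> S1) = conj_flips \<sigma> (SOME X. X \<in> S2)"
  obtain X where X: "S1 = {X, - X}" "det X = 1" "\<And>g. psl_eq (X ** \<sigma> g ** matrix_inv X) (\<sigma> g)"
    using psl_centraliser_generatorsE[OF S(1)] by blast
  obtain Y where Y: "S2 = {Y, - Y}" "det Y = 1" "\<And>g. psl_eq (Y ** \<sigma> g ** matrix_inv Y) (\<sigma> g)"
    using psl_centraliser_generatorsE[OF S(2)] by blast
  have det_\<sigma>: "det (\<sigma> g) = 1" for g
    using assms(2) by (simp add: psl_rep_S_def)
  have "conj_flips \<sigma> X = conj_flips \<sigma> Y"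
    using eq conj_flips_some X(1,2) Y(1,2) by metis
  then have "X ** \<sigma> g ** matrix_inv X = Y ** \<sigma> g ** matrix_inv Y" for g
    using X(3)[of g] Y(3)[of g] by (cases g) (auto simp: conj_flips_def psl_eq_def)
  then have "X = Y \<or> X = - Y"
    using eq_or_uminus_if_conj_eq[OF assms(1) det_\<sigma> X(2) Y(2)] by blast
  then show "S1 = S2"
    using X(1) Y(1) by auto
qed

lemma card_psl_centraliser_4_conjugators:
  assumes "irreducible_rep \<sigma>" "psl_rep_S \<sigma>" "card (psl_centraliser (rep_image \<sigma>)) = 4"
  shows "\<exists>X. det X = 1 \<and> X ** \<sigma> SA ** matrix_inv X = - \<sigma> SA \<and> X ** \<sigma> SB ** matrix_inv X = \<sigma> SB"
    and "\<exists>X. det X = 1 \<and> X ** \<sigma> SB ** matrix_inv X = - \<sigma> SB"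
proof -
  define C where "C = psl_centraliser (rep_image \<sigma>)"
  define f where "f S = conj_flips \<sigma> (SOME X. X \<in> S)" for S
  have "card (f ` C) = card (UNIV :: (bool \<times> bool) set)"
    using inj_on_conj_flips_psl_centraliser[OF assms(1,2)] assms(3)
    by (simp add: C_def f_def card_image card_UNIV_bool)
  then have "f ` C = UNIV"
    by (intro card_subset_eq) simp_all
  then obtain S1 S2 where S: "S1 \<in> C" "f S1 = (True, False)" "S2 \<in> C" "f S2 = (False, True)"
    by (metis UNIV_I imageE)
  obtain X where X: "S1 = {X, - X}" "det X = 1" "\<And>g. psl_eq (X ** \<sigma> g ** matrix_inv X) (\<sigma> g)"
    using psl_centraliser_generatorsE S(1) C_def by metis
  obtain Y where Y: "S2 = {Y, - Y}" "det Y = 1" "\<And>g. psl_eq (Y ** \<sigma> g ** matrix_inv Y) (\<sigma> g)"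
    using psl_centraliser_generatorsE S(3) C_def by metis
  have "conj_flips \<sigma> X = (True, False)" "conj_flips \<sigma> Y = (False, True)"
    using S(2,4) conj_flips_some X(1,2) Y(1,2) unfolding f_def by metis+
  then show "\<exists>X. det X = 1 \<and> X ** \<sigma> SA ** matrix_inv X = - \<sigma> SA \<and> X ** \<sigma> SB ** matrix_inv X = \<sigma> SB"
    and "\<exists>X. det X = 1 \<and> X ** \<sigma> SB ** matrix_inv X = - \<sigma> SB"
    using X(2) X(3)[of SA] X(3)[of SB] Y(2) Y(3)[of SB] unfolding conj_flips_def psl_eq_def by auto
qed

lemma trace_eq_0_if_conj_uminus:
  fixes X M :: cmat
  assumes "det X = 1" "X ** M ** matrix_inv X = - M"
  shows "trace M = 0"
proof -
  have "trace M = - trace M"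
    using trace_conj[of "matrix_inv X" X M] assms by (simp add: matrix_mul_inv_det1 trace_uminus)
  then show ?thesis by simp
qed

lemma card_psl_centraliser_4_traces:
  assumes "irreducible_rep \<sigma>" "psl_rep_S \<sigma>" "card (psl_centraliser (rep_image \<sigma>)) = 4"
  shows "trace (\<sigma> SA) = 0" "trace (\<sigma> SB) = 0" "trace (\<sigma> SA ** \<sigma> SB) = 0"
proof -
  obtain X where X: "det X = 1" "X ** \<sigma> SA ** matrix_inv X = - \<sigma> SA"
    "X ** \<sigma> SB ** matrix_inv X = \<sigma> SB"
    using card_psl_centraliser_4_conjugators(1)[OF assms] by blast
  obtain Y where Y: "det Y = 1" "Y ** \<sigma> SB ** matrix_inv Y = - \<sigma> SB"
    using card_psl_centraliser_4_conjugators(2)[OF assms] by blast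
  show "trace (\<sigma> SA) = 0" "trace (\<sigma> SB) = 0"
    using trace_eq_0_if_conj_uminus X(1,2) Y by blast+
  have "X ** (\<sigma> SA ** \<sigma> SB) ** matrix_inv X = - (\<sigma> SA ** \<sigma> SB)"
    using conj_mult[OF X(1)] X(2,3) by simp
  then show "trace (\<sigma> SA ** \<sigma> SB) = 0"
    using trace_eq_0_if_conj_uminus X(1) by blast
qed

section \<open>Normal form of a trace-free pair\<close>

lemma exists_i_eigenvector:
  fixes a b c :: complex
  assumes "a * a + b * c = -1"
  obtains v1 v2 where "(v1, v2) \<noteq> (0, 0)" "a * v1 + b * v2 = \<i> * v1" "c * v1 - a * v2 = \<i> * v2"
proof (cases "b = 0 \<and> a = \<i>")
  case True
  then show ?thesis
    using assms by (intro that[of "2 * \<i>" c]) (auto simp: algebra_simps)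
next
  case False
  show ?thesis
  proof (rule that[of b "\<i> - a"])
    show "(b, \<i> - a) \<noteq> (0, 0)" using False by auto
    show "a * b + b * (\<i> - a) = \<i> * b" by (simp add: algebra_simps)
    show "c * b - a * (\<i> - a) = \<i> * (\<i> - a)"
      using assms by (simp add: algebra_simps power2_eq_square)
  qed
qed

lemma i_eigenvectors_independent:
  fixes a b c v1 v2 w1 w2 :: complex
  assumes "(v1, v2) \<noteq> (0, 0)" "(w1, w2) \<noteq> (0, 0)"
    and "a * v1 + b * v2 = \<i> * v1" "c * v1 - a * v2 = \<i> * v2"
    and "a * w1 + b * w2 = - \<i> * w1" "c * w1 - a * w2 = - \<i> * w2"
  shows "w1 * v2 - v1 * w2 \<noteq> 0"
proof
  assume dependent: "w1 * v2 - v1 * w2 = 0"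
  obtain k where w: "w1 = k * v1" "w2 = k * v2"
  proof (cases "v1 = 0")
    case True
    with assms(1) dependent show ?thesis
      by (intro that[of "w2 / v2"]) (auto simp: field_simps)
  next
    case False
    with dependent show ?thesis
      by (intro that[of "w1 / v1"]) (auto simp: field_simps)
  qed
  have "k * (a * v1 + b * v2) = k * (\<i> * v1)" "k * (c * v1 - a * v2) = k * (\<i> * v2)"
    using assms(3,4) by simp_all
  then have "a * w1 + b * w2 = \<i> * w1" "c * w1 - a * w2 = \<i> * w2"
    by (simp_all add: w algebra_simps)
  with assms(2,5,6) show False
    by simp
qed

text \<open>If \<open>A v = i v\<close>, then \<open>B v\<close> is an eigenvector of \<open>A\<close> for \<open>-i\<close> (trace-free \<open>A\<close> and \<open>B\<close>
  with \<open>tr AB = 0\<close> anticommute); the basis \<open>v, -B v\<close> conjugates \<open>(A, B)\<close> to \<open>(I, J)\<close>.\<close>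

lemma trace_free_pair_conj_qI_qJ:
  fixes A B :: cmat
  assumes "det A = 1" "det B = 1" "trace A = 0" "trace B = 0" "trace (A ** B) = 0"
  obtains P Q where "P ** Q = mat 1" "Q ** P = mat 1" "P ** A ** Q = qI" "P ** B ** Q = qJ"
proof -
  obtain a b c d where A: "A = mat2 a b c d" by (rule mat2_cases)
  obtain e f g h where B: "B = mat2 e f g h" by (rule mat2_cases)
  have d: "d = - a" and h: "h = - e"
    using assms(3,4) A B by (simp_all add: add_eq_0_iff)
  have "a * (- a) - b * c = 1" "e * (- e) - f * g = 1"
    using assms(1,2) A B d h by simp_all
  then have det_A: "a * a + b * c = -1" and det_B: "e * e + f * g = -1"
    by algebra+
  have tr_AB: "2 * a * e + b * g + c * f = 0"
    using assms(5) A B d h by (simp add: algebra_simps)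
  obtain v1 v2 where v: "(v1, v2) \<noteq> (0, 0)" "a * v1 + b * v2 = \<i> * v1" "c * v1 - a * v2 = \<i> * v2"
    using exists_i_eigenvector[OF det_A] by blast
  define w1 w2 where "w1 = e * v1 + f * v2" and "w2 = g * v1 - e * v2"
  have w: "a * w1 + b * w2 = - \<i> * w1" "c * w1 - a * w2 = - \<i> * w2"
    using tr_AB v(2,3) unfolding w1_def w2_def by algebra+
  have "(w1, w2) \<noteq> (0, 0)"
  proof
    assume "(w1, w2) = (0, 0)"
    then have "e * w1 + f * w2 = 0" "g * w1 - e * w2 = 0" by auto
    then have "v1 = 0" "v2 = 0"
      using det_B unfolding w1_def w2_def by algebra+
    with v(1) show False by simp
  qed
  define D where "D = w1 * v2 - v1 * w2"
  have "D \<noteq> 0"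
    unfolding D_def by (rule i_eigenvectors_independent[OF v(1) \<open>(w1, w2) \<noteq> (0, 0)\<close> v(2,3) w])
  define Q where "Q = mat2 v1 (- w1) v2 (- w2)"
  define P where "P = mat2 (- w2 / D) (w1 / D) (- v2 / D) (v1 / D)"
  have PQ: "P ** Q = mat 1" "Q ** P = mat 1"
    using \<open>D \<noteq> 0\<close> by (simp_all add: P_def Q_def mat1_eq_mat2 divide_simps) (simp_all add: D_def algebra_simps)
  have "A ** Q = Q ** qI"
    unfolding A d Q_def quat_def using v(2,3) w by (simp only: mat2_mult mat2_eq_iff) algebra
  moreover have "B ** Q = Q ** qJ"
    unfolding B h Q_def quat_def w1_def w2_def using det_B by (simp only: mat2_mult mat2_eq_iff) algebra
  ultimately have "P ** A ** Q = qI" "P ** B ** Q = qJ"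
    by (metis PQ(1) matrix_mul_assoc matrix_mul_lid)+
  with PQ show ?thesis by (rule that)
qed

lemma pchar_eq_q8_rep_if_card_psl_centraliser_4:
  assumes "irreducible_rep \<sigma>" "psl_rep_S \<sigma>" "card (psl_centraliser (rep_image \<sigma>)) = 4"
  shows "pchar \<sigma> = pchar q8_rep"
proof -
  have det_\<sigma>: "det (\<sigma> g) = 1" for g
    using assms(2) by (simp add: psl_rep_S_def)
  obtain P Q where PQ: "P ** Q = mat 1" "Q ** P = mat 1" "P ** \<sigma> SA ** Q = qI" "P ** \<sigma> SB ** Q = qJ"
    using trace_free_pair_conj_qI_qJ[OF det_\<sigma> det_\<sigma> card_psl_centraliser_4_traces[OF assms]] .
  have "(\<lambda>g. P ** \<sigma> g ** Q) = q8_rep"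
    by (rule ext) (simp add: q8_rep_def PQ split: sgen.split)
  then show ?thesis
    using pchar_conj[where \<rho> = \<sigma>, OF PQ(1,2) det_\<sigma>] by simp
qed

section \<open>Representations of the bundle group extending the quaternion representation\<close>

lemma irreducible_q8_rep: "irreducible_rep q8_rep"
  unfolding irreducible_rep_def
proof
  assume "\<exists>v. v \<noteq> 0 \<and> (\<forall>M\<in>rep_image q8_rep. \<exists>c. M *v v = c *s v)"
  moreover have "qI \<in> rep_image q8_rep" "qJ \<in> rep_image q8_rep"
    using rangeI[of "mat_eval q8_rep" "[(False, SA)]"] rangeI[of "mat_eval q8_rep" "[(False, SB)]"]
    by (simp_all add: rep_image_def)
  ultimately obtain v c d where v: "v \<noteq> 0" "qI *v v = c *s v" "qJ *v v = d *s v"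
    by blast
  obtain x y where xy: "v = vec2 x y" by (rule vec2_cases)
  have e: "\<i> * x = c * x" "- \<i> * y = c * y" "y = d * x" "- x = d * y"
    using v(2,3) by (simp_all add: xy quat_def)
  have "x = 0"
  proof (rule ccontr)
    assume "x \<noteq> 0"
    with e(1) have "c = \<i>" by simp
    with e(2) have "y = 0" by simp
    with e(3,4) \<open>x \<noteq> 0\<close> show False by simp
  qed
  with e(3) v(1) xy show False
    by (simp add: vec2_eq_0_iff)
qed

lemma det_q8_rep: "det (q8_rep g) = 1"
  by (cases g) simp_all

lemma conj_qI_qJ_unique:
  fixes T T' :: cmat
  assumes "det T = 1" "det T' = 1"
    and "matrix_inv T ** qI ** T = matrix_inv T' ** qI ** T'"
    and "matrix_inv T ** qJ ** T = matrix_inv T' ** qJ ** T'"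
  shows "T' = T \<or> T' = - T"
proof -
  have "matrix_inv T ** q8_rep g ** matrix_inv (matrix_inv T)
      = matrix_inv T' ** q8_rep g ** matrix_inv (matrix_inv T')" for g
    using assms by (cases g) (simp_all add: matrix_inv_inv_det1)
  then have "matrix_inv T = matrix_inv T' \<or> matrix_inv T = - matrix_inv T'"
    by (rule eq_or_uminus_if_conj_eq[OF irreducible_q8_rep det_q8_rep det_matrix_inv_det1[OF assms(1)]
          det_matrix_inv_det1[OF assms(2)]])
  then have "matrix_inv (matrix_inv T) = matrix_inv (matrix_inv T')
      \<or> matrix_inv (matrix_inv T) = - matrix_inv (matrix_inv T')"
    by (metis matrix_inv_uminus_det1 det_matrix_inv_det1 assms(2))
  then show ?thesis
    using assms(1,2) by (auto simp: matrix_inv_inv_det1)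
qed

definition bundle_rep :: "cmat \<Rightarrow> mgen \<Rightarrow> cmat" where
  "bundle_rep T g = (case g of MT \<Rightarrow> T | MA \<Rightarrow> qI | MB \<Rightarrow> qJ)"

lemma bundle_rep_simps [simp]: "bundle_rep T MT = T" "bundle_rep T MA = qI" "bundle_rep T MB = qJ"
  by (simp_all add: bundle_rep_def)

lemma sgen_to_mgen_simps [simp]: "sgen_to_mgen SA = MA" "sgen_to_mgen SB = MB"
  by (simp_all add: sgen_to_mgen_def)

lemma bundle_rep_comp_sgen_to_mgen: "bundle_rep T \<circ> sgen_to_mgen = q8_rep"
  by (rule ext) (simp add: q8_rep_def split: sgen.split)

lemma all_mgen: "(\<forall>g. P g) \<longleftrightarrow> P MT \<and> P MA \<and> P MB"
  by (metis mgen.exhaust)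

lemma all_sgen: "(\<forall>g. P g) \<longleftrightarrow> P SA \<and> P SB"
  by (metis sgen.exhaust)

lemma mat_eval_conj_t: "mat_eval \<rho> (conj_t g) = matrix_inv (\<rho> MT) ** \<rho> (sgen_to_mgen g) ** \<rho> MT"
  by (simp add: conj_t_def matrix_mul_assoc)

lemma psl_rep_M_bundle_rep_iff:
  "psl_rep_M \<phi> (bundle_rep T) \<longleftrightarrow> det T = 1
     \<and> psl_eq (matrix_inv T ** qI ** T) (mat_eval q8_rep (\<phi> SA))
     \<and> psl_eq (matrix_inv T ** qJ ** T) (mat_eval q8_rep (\<phi> SB))"
  unfolding psl_rep_M_def all_mgen all_sgen mat_eval_conj_t mat_eval_embed_word
    bundle_rep_comp_sgen_to_mgen
  by simp

lemma sl_rep_M_bundle_rep_iff: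
  "sl_rep_M \<phi> (bundle_rep T) \<longleftrightarrow> det T = 1
     \<and> matrix_inv T ** qI ** T = mat_eval q8_rep (\<phi> SA)
     \<and> matrix_inv T ** qJ ** T = mat_eval q8_rep (\<phi> SB)"
  unfolding sl_rep_M_def all_mgen all_sgen mat_eval_conj_t mat_eval_embed_word
    bundle_rep_comp_sgen_to_mgen
  by simp

lemma sl_rep_M_imp_psl_rep_M: "sl_rep_M \<phi> \<rho> \<Longrightarrow> psl_rep_M \<phi> \<rho>"
  by (simp add: sl_rep_M_def psl_rep_M_def psl_eq_def)

lemma psl_rep_M_conj:
  fixes P Q :: cmat
  assumes "P ** Q = mat 1" "Q ** P = mat 1" "psl_rep_M \<phi> \<rho>"
  shows "psl_rep_M \<phi> (\<lambda>g. P ** \<rho> g ** Q)"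
proof -
  have det_\<rho>: "det (\<rho> g) = 1" for g
    using assms(3) by (simp add: psl_rep_M_def)
  with assms(3) show ?thesis
    unfolding psl_rep_M_def mat_eval_conj[OF assms(1,2) det_\<rho>] det_conj[OF assms(1)]
    by (simp add: psl_eq_conj)
qed

lemma sl_rep_M_conj:
  fixes P Q :: cmat
  assumes "P ** Q = mat 1" "Q ** P = mat 1" "sl_rep_M \<phi> \<rho>"
  shows "sl_rep_M \<phi> (\<lambda>g. P ** \<rho> g ** Q)"
proof -
  have det_\<rho>: "det (\<rho> g) = 1" for g
    using assms(3) by (simp add: sl_rep_M_def)
  with assms(3) show ?thesis
    unfolding sl_rep_M_def mat_eval_conj[OF assms(1,2) det_\<rho>] det_conj[OF assms(1)]
    by simp
qed

lemma rbar_pchar_bundle_rep: "rbar (pchar (bundle_rep T)) = pchar q8_rep"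
  by (simp add: rbar_def pchar_def mat_eval_embed_word bundle_rep_comp_sgen_to_mgen)

lemma pchar_bundle_rep_uminus: "det T = 1 \<Longrightarrow> pchar (bundle_rep (- T)) = pchar (bundle_rep T)"
  by (rule pchar_sign_change) (auto simp: bundle_rep_def split: mgen.split)

lemma conj_to_bundle_rep:
  assumes "psl_rep_M \<phi> \<rho>" "rbar (pchar \<rho>) = pchar q8_rep"
  obtains P Q T where "P ** Q = mat 1" "Q ** P = mat 1" "(\<lambda>g. P ** \<rho> g ** Q) = bundle_rep T"
    "pchar \<rho> = pchar (bundle_rep T)"
proof -
  have det_\<rho>: "det (\<rho> g) = 1" for g
    using assms(1) by (simp add: psl_rep_M_def)
  have "(trace (mat_eval \<rho> (embed_word w)))\<^sup>2 = (trace (mat_eval q8_rep w))\<^sup>2" for w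
    using fun_cong[OF assms(2), of w] by (simp add: rbar_def pchar_def)
  from this[of "[(False, SA)]"] this[of "[(False, SB)]"] this[of "[(False, SA), (False, SB)]"]
  have "trace (\<rho> MA) = 0" "trace (\<rho> MB) = 0" "trace (\<rho> MA ** \<rho> MB) = 0"
    by (simp_all add: embed_word_def)
  then obtain P Q where PQ: "P ** Q = mat 1" "Q ** P = mat 1" "P ** \<rho> MA ** Q = qI" "P ** \<rho> MB ** Q = qJ"
    using trace_free_pair_conj_qI_qJ det_\<rho> by metis
  then have conj: "(\<lambda>g. P ** \<rho> g ** Q) = bundle_rep (P ** \<rho> MT ** Q)"
    by (intro ext) (simp add: bundle_rep_def split: mgen.split)
  moreover have "pchar \<rho> = pchar (bundle_rep (P ** \<rho> MT ** Q))"
    using pchar_conj[where \<rho> = \<rho>, OF PQ(1,2) det_\<rho>] conj by simp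
  ultimately show ?thesis
    by (rule that[OF PQ(1,2)])
qed

section \<open>Orders in PSL(2,C)\<close>

lemma psl_order_eqI:
  assumes "0 < n" "psl_eq (((**) M ^^ n) (mat 1)) (mat 1)"
    and "\<And>m. 0 < m \<Longrightarrow> m < n \<Longrightarrow> \<not> psl_eq (((**) M ^^ m) (mat 1)) (mat 1)"
  shows "psl_order M = n"
proof -
  have "(LEAST n. 0 < n \<and> psl_eq (((**) M ^^ n) (mat 1)) (mat 1)) = n"
    by (rule Least_equality) (use assms in \<open>auto simp flip: not_less\<close>)
  with assms(1,2) show ?thesis
    unfolding psl_order_def by auto
qed

lemma psl_order_cong:
  assumes "\<And>n. psl_eq (((**) M ^^ n) (mat 1)) (mat 1) \<longleftrightarrow> psl_eq (((**) N ^^ n) (mat 1)) (mat 1)"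
  shows "psl_order M = psl_order N"
  unfolding psl_order_def assms ..

lemma funpow_mult_conj:
  fixes M P Q :: cmat
  assumes "Q ** P = mat 1" "P ** Q = mat 1"
  shows "((**) (P ** M ** Q) ^^ n) (mat 1) = P ** ((**) M ^^ n) (mat 1) ** Q"
proof (induction n)
  case (Suc n)
  have "P ** M ** Q ** (P ** N ** Q) = P ** (M ** N) ** Q" for N
    by (metis assms(1) matrix_mul_assoc matrix_mul_rid)
  with Suc show ?case by simp
qed (simp add: assms)

lemma psl_order_conj:
  fixes M P Q :: cmat
  assumes "Q ** P = mat 1" "P ** Q = mat 1"
  shows "psl_order (P ** M ** Q) = psl_order M"
proof (rule psl_order_cong)
  fix n
  have "psl_eq (P ** N ** Q) (mat 1) \<longleftrightarrow> psl_eq N (mat 1)" for N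
    using psl_eq_conj[of "P ** N ** Q" "mat 1" Q P] psl_eq_conj[of N "mat 1" P Q]
    by (auto simp: assms matrix_mul_conj_conj)
  then show "psl_eq (((**) (P ** M ** Q) ^^ n) (mat 1)) (mat 1) \<longleftrightarrow> psl_eq (((**) M ^^ n) (mat 1)) (mat 1)"
    by (simp add: funpow_mult_conj[OF assms])
qed

lemma psl_order_uminus: "psl_order (- M) = psl_order M"
proof (rule psl_order_cong)
  fix n
  have "psl_eq (((**) (- M) ^^ n) (mat 1)) (((**) M ^^ n) (mat 1))"
    by (induction n) (simp_all add: psl_eq_def, auto)
  then show "psl_eq (((**) (- M) ^^ n) (mat 1)) (mat 1) \<longleftrightarrow> psl_eq (((**) M ^^ n) (mat 1)) (mat 1)"
    using psl_eq_sym psl_eq_trans by blast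
qed

lemma psl_eq_quat_mat1_iff:
  "psl_eq (quat a0 a1 a2 a3) (mat 1) \<longleftrightarrow> (a0 = 1 \<or> a0 = -1) \<and> a1 = 0 \<and> a2 = 0 \<and> a3 = 0"
  by (auto simp: psl_eq_def mat1_eq_quat)

lemma psl_order_quat_1: "psl_order (quat 1 0 0 0) = 1"
  by (rule psl_order_eqI) (simp_all add: psl_eq_quat_mat1_iff flip: mat1_eq_quat)

lemma psl_order_pure_quat:
  assumes "x1 * x1 + x2 * x2 + x3 * x3 = 1"
  shows "psl_order (quat 0 x1 x2 x3) = 2"
proof (rule psl_order_eqI)
  have "quat 0 x1 x2 x3 ** quat 0 x1 x2 x3 = quat (-1) 0 0 0"
    using assms by (simp add: algebra_simps)
  then show "psl_eq (((**) (quat 0 x1 x2 x3) ^^ 2) (mat 1)) (mat 1)"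
    by (simp add: numeral_eq_Suc psl_eq_quat_mat1_iff)
qed (auto simp: less_Suc_eq numeral_eq_Suc psl_eq_quat_mat1_iff)

text \<open>For \<open>q = (1 + u) / \<surd>2\<close> with \<open>u\<close> a pure unit quaternion, \<open>q\<^sup>2 = u\<close> and \<open>q\<^sup>4 = -1\<close>.\<close>

lemma psl_order_quat_half:
  assumes "c * c = 1 / 2" "x1 * x1 + x2 * x2 + x3 * x3 = 1 / 2"
  shows "psl_order (quat c x1 x2 x3) = 4"
proof (rule psl_order_eqI)
  define q where "q = quat c x1 x2 x3"
  have q2: "q ** q = quat 0 (2 * c * x1) (2 * c * x2) (2 * c * x3)"
    using assms unfolding q_def by simp algebra
  have q3: "q ** (q ** q) = quat (- c) x1 x2 x3"
    using assms unfolding q2 unfolding q_def by simp algebra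
  have q4: "q ** (q ** (q ** q)) = quat (-1) 0 0 0"
    using assms unfolding q3 unfolding q_def by simp algebra
  have "c \<noteq> 1" "c \<noteq> -1"
    using assms(1) by auto
  moreover from this have "- c \<noteq> 1" "- c \<noteq> -1"
    by (auto simp: minus_equation_iff)
  ultimately show "psl_eq (((**) q ^^ 4) (mat 1)) (mat 1)"
    "\<And>m. 0 < m \<Longrightarrow> m < 4 \<Longrightarrow> \<not> psl_eq (((**) q ^^ m) (mat 1)) (mat 1)"
    using q2 q3 q4 by (auto simp: less_Suc_eq numeral_eq_Suc psl_eq_quat_mat1_iff q_def)
qed simp

section \<open>The fibre of the restriction map over the quaternion character\<close>

definition signed :: "bool \<Rightarrow> cmat \<Rightarrow> cmat" where
  "signed s M = (if s then - M else M)"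

lemma psl_eq_signed [simp]: "psl_eq (signed s M) M"
  by (simp add: psl_eq_def signed_def)

lemma psl_eq_signedE:
  assumes "psl_eq M N"
  obtains s where "M = signed s N"
  using assms that[of False] that[of True] by (auto simp: psl_eq_def signed_def)

text \<open>The signs \<open>s\<close>, \<open>t\<close> index the four sign choices in \<open>T\<^sup>-\<^sup>1 I T = \<plusminus>U\<close>, \<open>T\<^sup>-\<^sup>1 J T = \<plusminus>V\<close>;
  by \<open>conj_qI_qJ_unique\<close> all solutions are the \<open>\<plusminus>T s t\<close> (\<open>sign_conjugators_unique\<close>).\<close>

definition sign_conjugators :: "cmat \<Rightarrow> cmat \<Rightarrow> (bool \<Rightarrow> bool \<Rightarrow> cmat) \<Rightarrow> bool" where
  "sign_conjugators U V T \<longleftrightarrow> (\<forall>s t. det (T s t) = 1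
     \<and> matrix_inv (T s t) ** qI ** T s t = signed s U \<and> matrix_inv (T s t) ** qJ ** T s t = signed t V)"

context
  fixes \<phi> U V and T :: "bool \<Rightarrow> bool \<Rightarrow> cmat"
  assumes U: "psl_eq (mat_eval q8_rep (\<phi> SA)) U"
    and V: "psl_eq (mat_eval q8_rep (\<phi> SB)) V"
    and T: "sign_conjugators U V T"
begin

lemma det_sign_conjugator: "det (T s t) = 1"
  using T by (simp add: sign_conjugators_def)

lemma conj_sign_conjugator:
  assumes "T' = T s t \<or> T' = - T s t"
  shows "det T' = 1" "matrix_inv T' ** qI ** T' = signed s U" "matrix_inv T' ** qJ ** T' = signed t V"
  using assms T det_sign_conjugator[of s t]
  by (auto simp: sign_conjugators_def matrix_inv_uminus_det1 det_uminus)

lemma sign_conjugators_unique: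
  assumes "det T' = 1" "matrix_inv T' ** qI ** T' = signed s U" "matrix_inv T' ** qJ ** T' = signed t V"
  shows "T' = T s t \<or> T' = - T s t"
  using conj_qI_qJ_unique[OF det_sign_conjugator assms(1)] conj_sign_conjugator[of "T s t" s t] assms(2,3)
  by simp

lemma psl_rep_M_bundle_rep_iff_sign_conjugator:
  "psl_rep_M \<phi> (bundle_rep T') \<longleftrightarrow> (\<exists>s t. T' = T s t \<or> T' = - T s t)"
proof
  assume "psl_rep_M \<phi> (bundle_rep T')"
  then have "det T' = 1" "psl_eq (matrix_inv T' ** qI ** T') U" "psl_eq (matrix_inv T' ** qJ ** T') V"
    using U V psl_eq_trans unfolding psl_rep_M_bundle_rep_iff by blast+
  moreover obtain s where "matrix_inv T' ** qI ** T' = signed s U"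
    using psl_eq_signedE[OF \<open>psl_eq (matrix_inv T' ** qI ** T') U\<close>] .
  moreover obtain t where "matrix_inv T' ** qJ ** T' = signed t V"
    using psl_eq_signedE[OF \<open>psl_eq (matrix_inv T' ** qJ ** T') V\<close>] .
  ultimately show "\<exists>s t. T' = T s t \<or> T' = - T s t"
    using sign_conjugators_unique by blast
next
  assume "\<exists>s t. T' = T s t \<or> T' = - T s t"
  then obtain s t where "T' = T s t \<or> T' = - T s t" by blast
  note conj = conj_sign_conjugator[OF this]
  have "psl_eq (matrix_inv T' ** qI ** T') (mat_eval q8_rep (\<phi> SA))"
    unfolding conj(2) using psl_eq_signed U psl_eq_sym psl_eq_trans by blast
  moreover have "psl_eq (matrix_inv T' ** qJ ** T') (mat_eval q8_rep (\<phi> SB))"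
    unfolding conj(3) using psl_eq_signed V psl_eq_sym psl_eq_trans by blast
  ultimately show "psl_rep_M \<phi> (bundle_rep T')"
    using conj(1) by (simp add: psl_rep_M_bundle_rep_iff)
qed

lemma sl_rep_M_bundle_rep_sign_conjugator:
  "\<exists>s t. \<forall>T'. sl_rep_M \<phi> (bundle_rep T') \<longleftrightarrow> T' = T s t \<or> T' = - T s t"
proof -
  obtain s where s: "mat_eval q8_rep (\<phi> SA) = signed s U"
    using psl_eq_signedE[OF U] .
  obtain t where t: "mat_eval q8_rep (\<phi> SB) = signed t V"
    using psl_eq_signedE[OF V] .
  have "sl_rep_M \<phi> (bundle_rep T') \<longleftrightarrow> T' = T s t \<or> T' = - T s t" for T'
  proof
    assume "sl_rep_M \<phi> (bundle_rep T')"
    then show "T' = T s t \<or> T' = - T s t"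
      using sign_conjugators_unique unfolding sl_rep_M_bundle_rep_iff s t by blast
  next
    assume "T' = T s t \<or> T' = - T s t"
    then show "sl_rep_M \<phi> (bundle_rep T')"
      using conj_sign_conjugator unfolding sl_rep_M_bundle_rep_iff s t by blast
  qed
  then show ?thesis by blast
qed

lemma pchar_bundle_rep_sign_conjugator:
  "T' = T s t \<or> T' = - T s t \<Longrightarrow> pchar (bundle_rep T') = pchar (bundle_rep (T s t))"
  using pchar_bundle_rep_uminus[OF det_sign_conjugator] by auto

lemma fibre_rep_conj_sign_conjugator:
  assumes "psl_rep_M \<phi> \<rho>" "rbar (pchar \<rho>) = pchar q8_rep"
  obtains P Q s t where "P ** Q = mat 1" "Q ** P = mat 1"
    "P ** \<rho> MT ** Q = T s t \<or> P ** \<rho> MT ** Q = - T s t" "pchar \<rho> = pchar (bundle_rep (T s t))"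
proof -
  obtain P Q T' where PQ: "P ** Q = mat 1" "Q ** P = mat 1" "(\<lambda>g. P ** \<rho> g ** Q) = bundle_rep T'"
      "pchar \<rho> = pchar (bundle_rep T')"
    using conj_to_bundle_rep[OF assms] by blast
  have "psl_rep_M \<phi> (bundle_rep T')"
    using psl_rep_M_conj[OF PQ(1,2) assms(1)] PQ(3) by simp
  then obtain s t where st: "T' = T s t \<or> T' = - T s t"
    using psl_rep_M_bundle_rep_iff_sign_conjugator by blast
  have "P ** \<rho> MT ** Q = T'"
    using fun_cong[OF PQ(3), of MT] by simp
  with st have "P ** \<rho> MT ** Q = T s t \<or> P ** \<rho> MT ** Q = - T s t"
    by simp
  moreover have "pchar \<rho> = pchar (bundle_rep (T s t))"
    using PQ(4) pchar_bundle_rep_sign_conjugator[OF st] by simp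
  ultimately show ?thesis
    by (rule that[OF PQ(1,2)])
qed

lemma rbar_fibre_q8_rep:
  "rbar_fibre \<phi> (pchar q8_rep) = {pchar (bundle_rep (T s t)) | s t. True}"
proof (intro equalityI subsetI)
  fix chi assume "chi \<in> rbar_fibre \<phi> (pchar q8_rep)"
  then obtain \<rho> where \<rho>: "chi = pchar \<rho>" "psl_rep_M \<phi> \<rho>" "rbar (pchar \<rho>) = pchar q8_rep"
    unfolding rbar_fibre_def Xbar_M_def by blast
  obtain P Q s t where "P ** Q = mat 1" "Q ** P = mat 1"
      "P ** \<rho> MT ** Q = T s t \<or> P ** \<rho> MT ** Q = - T s t" "pchar \<rho> = pchar (bundle_rep (T s t))"
    using fibre_rep_conj_sign_conjugator[OF \<rho>(2,3)] .
  with \<rho>(1) show "chi \<in> {pchar (bundle_rep (T s t)) | s t. True}"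
    by blast
next
  fix chi assume "chi \<in> {pchar (bundle_rep (T s t)) | s t. True}"
  then obtain s t where "chi = pchar (bundle_rep (T s t))" by blast
  moreover have "psl_rep_M \<phi> (bundle_rep (T s t))"
    using psl_rep_M_bundle_rep_iff_sign_conjugator by blast
  ultimately show "chi \<in> rbar_fibre \<phi> (pchar q8_rep)"
    unfolding rbar_fibre_def Xbar_M_def by (auto simp: rbar_pchar_bundle_rep)
qed

lemma lifts_to_X_rbar_fibre_q8_rep:
  "\<exists>s t. {chi \<in> rbar_fibre \<phi> (pchar q8_rep). lifts_to_X \<phi> chi} = {pchar (bundle_rep (T s t))}"
proof -
  obtain s t where st: "\<And>T'. sl_rep_M \<phi> (bundle_rep T') \<longleftrightarrow> T' = T s t \<or> T' = - T s t"
    using sl_rep_M_bundle_rep_sign_conjugator by blast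
  have lifts_iff: "lifts_to_X \<phi> chi \<longleftrightarrow> (\<exists>\<rho>. sl_rep_M \<phi> \<rho> \<and> chi = pchar \<rho>)" for chi
    unfolding lifts_to_X_def X_M_def pchar_def schar_def Bex_def mem_Collect_eq by metis
  have lifted: "pchar \<rho> = pchar (bundle_rep (T s t))"
    if sl: "sl_rep_M \<phi> \<rho>" and fibre: "rbar (pchar \<rho>) = pchar q8_rep" for \<rho>
  proof -
    obtain P Q T' where PQ: "P ** Q = mat 1" "Q ** P = mat 1" "(\<lambda>g. P ** \<rho> g ** Q) = bundle_rep T'"
        "pchar \<rho> = pchar (bundle_rep T')"
      using conj_to_bundle_rep[OF sl_rep_M_imp_psl_rep_M[OF sl] fibre] by blast
    have "sl_rep_M \<phi> (bundle_rep T')"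
      using sl_rep_M_conj[OF PQ(1,2) sl] PQ(3) by simp
    then have "T' = T s t \<or> T' = - T s t"
      using st by blast
    then show ?thesis
      using PQ(4) pchar_bundle_rep_sign_conjugator by simp
  qed
  have "{chi \<in> rbar_fibre \<phi> (pchar q8_rep). lifts_to_X \<phi> chi} = {pchar (bundle_rep (T s t))}"
  proof (intro equalityI subsetI)
    fix chi assume "chi \<in> {chi \<in> rbar_fibre \<phi> (pchar q8_rep). lifts_to_X \<phi> chi}"
    then obtain \<rho> where "sl_rep_M \<phi> \<rho>" "chi = pchar \<rho>" "rbar chi = pchar q8_rep"
      unfolding lifts_iff rbar_fibre_def by blast
    then show "chi \<in> {pchar (bundle_rep (T s t))}"
      using lifted by simp
  next
    fix chi assume "chi \<in> {pchar (bundle_rep (T s t))}"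
    moreover have "sl_rep_M \<phi> (bundle_rep (T s t))"
      using st by blast
    moreover have "pchar (bundle_rep (T s t)) \<in> rbar_fibre \<phi> (pchar q8_rep)"
      unfolding rbar_fibre_q8_rep by blast
    ultimately show "chi \<in> {chi \<in> rbar_fibre \<phi> (pchar q8_rep). lifts_to_X \<phi> chi}"
      unfolding lifts_iff by blast
  qed
  then show ?thesis by blast
qed

lemma psl_order_meridian_rbar_fibre_q8_rep:
  assumes "psl_rep_M \<phi> \<rho>" "rbar (pchar \<rho>) = pchar q8_rep"
  shows "\<exists>s t. psl_order (\<rho> MT) = psl_order (T s t)"
proof -
  obtain P Q s t where PQ: "P ** Q = mat 1" "Q ** P = mat 1"
    "P ** \<rho> MT ** Q = T s t \<or> P ** \<rho> MT ** Q = - T s t" "pchar \<rho> = pchar (bundle_rep (T s t))"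
    using fibre_rep_conj_sign_conjugator[OF assms] .
  have "psl_order (\<rho> MT) = psl_order (P ** \<rho> MT ** Q)"
    using psl_order_conj[OF PQ(2,1)] by simp
  also have "\<dots> = psl_order (T s t)"
    using PQ(3) by (elim disjE) (simp_all add: psl_order_uminus)
  finally show ?thesis by blast
qed

end

lemma mat_eval_bundle_rep_longitude: "mat_eval (bundle_rep T) longitude = - mat 1"
  by (simp add: longitude_def mat1_eq_quat)

lemma longitude_rbar_fibre_q8_rep:
  assumes "psl_rep_M \<phi> \<rho>" "rbar (pchar \<rho>) = pchar q8_rep"
  shows "psl_eq (mat_eval \<rho> longitude) (mat 1)"
proof -
  obtain P Q T where PQ: "P ** Q = mat 1" "Q ** P = mat 1" "(\<lambda>g. P ** \<rho> g ** Q) = bundle_rep T"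
    using conj_to_bundle_rep[OF assms] by blast
  have det_\<rho>: "det (\<rho> g) = 1" for g
    using assms(1) by (simp add: psl_rep_M_def)
  have "P ** mat_eval \<rho> longitude ** Q = - mat 1"
    using mat_eval_conj[where \<rho> = \<rho>, OF PQ(1,2) det_\<rho>, of longitude] PQ(3) mat_eval_bundle_rep_longitude
    by simp
  then have "mat_eval \<rho> longitude = - (Q ** P)"
    using matrix_mul_conj_conj[OF PQ(2), of "mat_eval \<rho> longitude"] by simp
  then show ?thesis
    using PQ(2) by (simp add: psl_eq_def)
qed

section \<open>The mod 2 Betti number\<close>

definition ab_parity :: "(sgen \<Rightarrow> sgen word) \<Rightarrow> sgen \<Rightarrow> sgen \<Rightarrow> bool" where
  "ab_parity \<phi> g h = odd (exp_sum h (\<phi> g))"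

lemma psl_eq_mat_eval_q8_rep_image:
  "psl_eq (mat_eval q8_rep (\<phi> g)) (q8 (ab_parity \<phi> g SA) (ab_parity \<phi> g SB))"
  unfolding ab_parity_def by (rule psl_eq_mat_eval_q8_rep)

lemma z2_eval_Nil [simp]: "z2_eval h [] = False"
  by (simp add: z2_eval_def)

lemma z2_eval_Cons [simp]: "z2_eval h ((e, g) # w) = (h g \<noteq> z2_eval h w)"
  by (simp add: z2_eval_def)

lemma z2_eval_embed_word: "z2_eval h (embed_word w) = z2_eval (h \<circ> sgen_to_mgen) w"
  by (induction w) (auto simp: embed_word_def)

lemma z2_eval_exp_sum:
  "z2_eval h w = ((h SA \<and> odd (exp_sum SA w)) \<noteq> (h SB \<and> odd (exp_sum SB w)))"
proof (induction w)
  case (Cons l w)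
  then show ?case by (cases l; cases "snd l") auto
qed simp

lemma z2_homs_M_eq:
  "z2_homs_M \<phi> = {h. h MA = ((h MA \<and> ab_parity \<phi> SA SA) \<noteq> (h MB \<and> ab_parity \<phi> SA SB))
                   \<and> h MB = ((h MA \<and> ab_parity \<phi> SB SA) \<noteq> (h MB \<and> ab_parity \<phi> SB SB))}"
  unfolding z2_homs_M_def all_sgen z2_eval_embed_word z2_eval_exp_sum ab_parity_def
  by (auto simp: conj_t_def)

lemma card_mgen_homs: "card {h :: mgen \<Rightarrow> bool. P (h MA) (h MB)} = 2 * card {(y, z). P y z}"
proof -
  define hom where "hom x y z = (\<lambda>g. case g of MT \<Rightarrow> x | MA \<Rightarrow> y | MB \<Rightarrow> z)" for x y z :: bool
  have "{h :: mgen \<Rightarrow> bool. P (h MA) (h MB)} = (\<lambda>(x, y, z). hom x y z) ` (UNIV \<times> {(y, z). P y z})"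
  proof (intro equalityI subsetI)
    fix h :: "mgen \<Rightarrow> bool" assume "h \<in> {h. P (h MA) (h MB)}"
    moreover have "h = hom (h MT) (h MA) (h MB)"
      by (rule ext) (simp add: hom_def split: mgen.split)
    ultimately show "h \<in> (\<lambda>(x, y, z). hom x y z) ` (UNIV \<times> {(y, z). P y z})"
      by (intro image_eqI[of _ _ "(h MT, h MA, h MB)"]) auto
  qed (auto simp: hom_def)
  moreover have "inj (\<lambda>(x, y, z). hom x y z)"
    by (rule injI) (auto simp: hom_def fun_eq_iff all_mgen)
  ultimately show ?thesis
    by (simp add: card_image inj_on_subset card_cartesian_product card_UNIV_bool)
qed

lemma b1_eqI:
  assumes "{(y, z). y = ((y \<and> ab_parity \<phi> SA SA) \<noteq> (z \<and> ab_parity \<phi> SA SB))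
                  \<and> z = ((y \<and> ab_parity \<phi> SB SA) \<noteq> (z \<and> ab_parity \<phi> SB SB))} = S"
    and "2 * card S = 2 ^ k"
  shows "b1 \<phi> = k"
proof -
  have "card (z2_homs_M \<phi>) = 2 * card {(y, z). y = ((y \<and> ab_parity \<phi> SA SA) \<noteq> (z \<and> ab_parity \<phi> SA SB))
                  \<and> z = ((y \<and> ab_parity \<phi> SB SA) \<noteq> (z \<and> ab_parity \<phi> SB SB))}"
    unfolding z2_homs_M_eq by (rule card_mgen_homs)
  then have card: "card (z2_homs_M \<phi>) = 2 ^ k"
    using assms by simp
  show ?thesis
    unfolding b1_def
  proof (rule the_equality)
    show "n = k" if "card (z2_homs_M \<phi>) = 2 ^ n" for n
      using card that by (simp add: power_inject_exp)
  qed (fact card)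
qed

section \<open>The six parity patterns\<close>

lemma pchar_bundle_rep_conj_q8:
  assumes "D = qI \<or> D = qJ" "det T = 1"
  shows "pchar (bundle_rep (matrix_inv D ** T ** D)) = pchar (bundle_rep T)"
proof -
  have D: "D ** matrix_inv D = mat 1" "matrix_inv D ** D = mat 1"
    using assms(1) by (auto simp: matrix_mul_inv_det1 mat1_eq_quat)
  have det_\<rho>: "det (bundle_rep T g) = 1" for g
    using assms(2) by (simp add: bundle_rep_def split: mgen.split)
  have "bundle_rep (matrix_inv D ** T ** D) g = matrix_inv D ** bundle_rep T g ** D
      \<or> bundle_rep (matrix_inv D ** T ** D) g = - (matrix_inv D ** bundle_rep T g ** D)" for g
    using assms(1) by (cases g) (auto simp: mat1_eq_quat)
  then have "pchar (bundle_rep (matrix_inv D ** T ** D)) = pchar (\<lambda>g. matrix_inv D ** bundle_rep T g ** D)"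
    by (rule pchar_sign_change) (simp add: det_conj[OF D(2)] det_\<rho>)
  also have "\<dots> = pchar (bundle_rep T)"
    by (rule pchar_conj[OF D(2,1) det_\<rho>])
  finally show ?thesis .
qed

lemma
  assumes "x0 * x0 + x1 * x1 + x2 * x2 + x3 * x3 = 1"
  shows pchar_bundle_rep_quat_conj_qI:
      "pchar (bundle_rep (quat x0 x1 (- x2) (- x3))) = pchar (bundle_rep (quat x0 x1 x2 x3))"
    and pchar_bundle_rep_quat_conj_qJ:
      "pchar (bundle_rep (quat x0 (- x1) x2 (- x3))) = pchar (bundle_rep (quat x0 x1 x2 x3))"
  using pchar_bundle_rep_conj_q8[of qI "quat x0 x1 x2 x3"] pchar_bundle_rep_conj_q8[of qJ "quat x0 x1 x2 x3"]
    assms by simp_all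

lemma pchar_bundle_rep_quat_words:
  "pchar (bundle_rep (quat x0 x1 x2 x3)) [(False, MT)] = 4 * (x0 * x0)"
  "pchar (bundle_rep (quat x0 x1 x2 x3)) [(False, MT), (False, MA)] = 4 * (x1 * x1)"
  "pchar (bundle_rep (quat x0 x1 x2 x3)) [(False, MT), (False, MB)] = 4 * (x2 * x2)"
  by (simp_all add: pchar_def power2_eq_square)

lemma pchar_bundle_rep_quat_neq:
  assumes "x0 * x0 \<noteq> y0 * y0 \<or> x1 * x1 \<noteq> y1 * y1 \<or> x2 * x2 \<noteq> y2 * y2"
  shows "pchar (bundle_rep (quat x0 x1 x2 x3)) \<noteq> pchar (bundle_rep (quat y0 y1 y2 y3))"
proof
  assume "pchar (bundle_rep (quat x0 x1 x2 x3)) = pchar (bundle_rep (quat y0 y1 y2 y3))"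
  with assms show False
    by (metis pchar_bundle_rep_quat_words mult_cancel_left zero_neq_numeral)
qed

lemma setcompr_bool_bool: "{f s t | s t. True} = {f False False, f False True, f True False, f True True}"
  by (auto, metis (full_types))

lemma exists_sqrt_half: "\<exists>r :: complex. r * r = 1 / 2"
  by (metis power2_csqrt power2_eq_square)

lemma mult_mult_sqrt_half: "r * r = 1 / 2 \<Longrightarrow> r * (r * x) = x / (2::complex)"
  by (simp add: mult.assoc[symmetric])

lemma sign_conjugators_qI_qJ:
  "\<exists>T. sign_conjugators qI qJ T \<and> card {pchar (bundle_rep (T s t)) | s t. True} = 4
     \<and> (\<forall>s t. psl_order (T s t) \<in> {1, 2})"
proof -
  define T where "T s t = (if s then if t then qK else qJ else if t then qI else quat 1 0 0 0)" for s t
  have "sign_conjugators qI qJ T"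
    by (simp add: sign_conjugators_def T_def signed_def all_bool_eq)
  moreover have "card {pchar (bundle_rep (T s t)) | s t. True} = 4"
    unfolding setcompr_bool_bool T_def by (simp add: pchar_bundle_rep_quat_neq)
  moreover have "\<forall>s t. psl_order (T s t) \<in> {1, 2}"
    by (simp add: T_def all_bool_eq psl_order_quat_1 psl_order_pure_quat)
  ultimately show ?thesis by blast
qed

lemma sign_conjugators_qJ_qI:
  "\<exists>T. sign_conjugators qJ qI T \<and> card {pchar (bundle_rep (T s t)) | s t. True} = 2
     \<and> (\<forall>s t. psl_order (T s t) \<in> {2, 4})"
proof -
  obtain r :: complex where r: "r * r = 1 / 2" "\<And>x. r * (r * x) = x / 2"
    using exists_sqrt_half mult_mult_sqrt_half by blast
  define T where
    "T s t = (if s then if t then quat 0 r (- r) 0 else quat r 0 0 r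
              else if t then quat r 0 0 (- r) else quat 0 r r 0)" for s t
  have "sign_conjugators qJ qI T"
    by (simp add: sign_conjugators_def T_def signed_def all_bool_eq r)
  moreover have "card {pchar (bundle_rep (T s t)) | s t. True} = 2"
    using pchar_bundle_rep_quat_conj_qI[of 0 r r 0] pchar_bundle_rep_quat_conj_qI[of r 0 0 "- r"]
    unfolding setcompr_bool_bool T_def by (simp add: pchar_bundle_rep_quat_neq insert_commute r)
  moreover have "\<forall>s t. psl_order (T s t) \<in> {2, 4}"
    by (simp add: T_def all_bool_eq psl_order_pure_quat psl_order_quat_half r)
  ultimately show ?thesis by blast
qed

lemma sign_conjugators_qI_qK:
  "\<exists>T. sign_conjugators qI qK T \<and> card {pchar (bundle_rep (T s t)) | s t. True} = 2
     \<and> (\<forall>s t. psl_order (T s t) \<in> {2, 4})"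
proof -
  obtain r :: complex where r: "r * r = 1 / 2" "\<And>x. r * (r * x) = x / 2"
    using exists_sqrt_half mult_mult_sqrt_half by blast
  define T where
    "T s t = (if s then if t then quat 0 0 r (- r) else quat 0 0 r r
              else if t then quat r r 0 0 else quat r (- r) 0 0)" for s t
  have "sign_conjugators qI qK T"
    by (simp add: sign_conjugators_def T_def signed_def all_bool_eq r)
  moreover have "card {pchar (bundle_rep (T s t)) | s t. True} = 2"
    using pchar_bundle_rep_quat_conj_qJ[of r "- r" 0 0] pchar_bundle_rep_quat_conj_qJ[of 0 0 r r]
    unfolding setcompr_bool_bool T_def by (simp add: pchar_bundle_rep_quat_neq insert_commute r)
  moreover have "\<forall>s t. psl_order (T s t) \<in> {2, 4}"
    by (simp add: T_def all_bool_eq psl_order_pure_quat psl_order_quat_half r)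
  ultimately show ?thesis by blast
qed

lemma sign_conjugators_qK_qJ:
  "\<exists>T. sign_conjugators qK qJ T \<and> card {pchar (bundle_rep (T s t)) | s t. True} = 2
     \<and> (\<forall>s t. psl_order (T s t) \<in> {2, 4})"
proof -
  obtain r :: complex where r: "r * r = 1 / 2" "\<And>x. r * (r * x) = x / 2"
    using exists_sqrt_half mult_mult_sqrt_half by blast
  define T where
    "T s t = (if s then if t then quat 0 r 0 (- r) else quat r 0 (- r) 0
              else if t then quat 0 r 0 r else quat r 0 r 0)" for s t
  have "sign_conjugators qK qJ T"
    by (simp add: sign_conjugators_def T_def signed_def all_bool_eq r)
  moreover have "card {pchar (bundle_rep (T s t)) | s t. True} = 2"
    using pchar_bundle_rep_quat_conj_qI[of r 0 r 0] pchar_bundle_rep_quat_conj_qI[of 0 r 0 r]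
    unfolding setcompr_bool_bool T_def by (simp add: pchar_bundle_rep_quat_neq insert_commute r)
  moreover have "\<forall>s t. psl_order (T s t) \<in> {2, 4}"
    by (simp add: T_def all_bool_eq psl_order_pure_quat psl_order_quat_half r)
  ultimately show ?thesis by blast
qed

lemma sign_conjugators_qJ_qK:
  "\<exists>T. sign_conjugators qJ qK T \<and> card {pchar (bundle_rep (T s t)) | s t. True} = 1"
proof -
  define h :: complex where "h = 1 / 2"
  define T where
    "T s t = (if s then if t then quat h h (- h) h else quat h (- h) h h
              else if t then quat h h h (- h) else quat h (- h) (- h) (- h))" for s t
  have "sign_conjugators qJ qK T"
    by (simp add: sign_conjugators_def T_def signed_def all_bool_eq h_def)
  moreover have "card {pchar (bundle_rep (T s t)) | s t. True} = 1"
    using pchar_bundle_rep_quat_conj_qI[of h "- h" "- h" "- h"] pchar_bundle_rep_quat_conj_qJ[of h "- h" "- h" "- h"]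
      pchar_bundle_rep_quat_conj_qJ[of h "- h" h h]
    unfolding setcompr_bool_bool T_def by (simp add: h_def)
  ultimately show ?thesis by blast
qed

lemma sign_conjugators_qK_qI:
  "\<exists>T. sign_conjugators qK qI T \<and> card {pchar (bundle_rep (T s t)) | s t. True} = 1"
proof -
  define h :: complex where "h = 1 / 2"
  define T where
    "T s t = (if s then if t then quat h h (- h) (- h) else quat h (- h) (- h) h
              else if t then quat h (- h) h (- h) else quat h h h h)" for s t
  have "sign_conjugators qK qI T"
    by (simp add: sign_conjugators_def T_def signed_def all_bool_eq h_def)
  moreover have "card {pchar (bundle_rep (T s t)) | s t. True} = 1"
    using pchar_bundle_rep_quat_conj_qI[of h h h h] pchar_bundle_rep_quat_conj_qJ[of h h h h]
      pchar_bundle_rep_quat_conj_qI[of h "- h" h "- h"]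
    unfolding setcompr_bool_bool T_def by (simp add: h_def)
  ultimately show ?thesis by blast
qed

lemma parity_patterns:
  assumes "ab_det \<phi> = 1"
  obtains (I_J) "ab_parity \<phi> SA SA" "\<not> ab_parity \<phi> SA SB" "\<not> ab_parity \<phi> SB SA" "ab_parity \<phi> SB SB"
    | (J_I) "\<not> ab_parity \<phi> SA SA" "ab_parity \<phi> SA SB" "ab_parity \<phi> SB SA" "\<not> ab_parity \<phi> SB SB"
    | (I_K) "ab_parity \<phi> SA SA" "\<not> ab_parity \<phi> SA SB" "ab_parity \<phi> SB SA" "ab_parity \<phi> SB SB"
    | (K_J) "ab_parity \<phi> SA SA" "ab_parity \<phi> SA SB" "\<not> ab_parity \<phi> SB SA" "ab_parity \<phi> SB SB"
    | (J_K) "\<not> ab_parity \<phi> SA SA" "ab_parity \<phi> SA SB" "ab_parity \<phi> SB SA" "ab_parity \<phi> SB SB"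
    | (K_I) "ab_parity \<phi> SA SA" "ab_parity \<phi> SA SB" "ab_parity \<phi> SB SA" "\<not> ab_parity \<phi> SB SB"
proof -
  have "odd (ab_det \<phi>)"
    using assms by simp
  then have "(ab_parity \<phi> SA SA \<and> ab_parity \<phi> SB SB) \<noteq> (ab_parity \<phi> SA SB \<and> ab_parity \<phi> SB SA)"
    unfolding ab_det_def ab_parity_def by auto
  with that show ?thesis
    by blast
qed

lemma sign_conjugators_of_parities:
  assumes "ab_det \<phi> = 1"
  shows "\<exists>T. sign_conjugators (q8 (ab_parity \<phi> SA SA) (ab_parity \<phi> SA SB))
                             (q8 (ab_parity \<phi> SB SA) (ab_parity \<phi> SB SB)) T
     \<and> card {pchar (bundle_rep (T s t)) | s t. True} = 2 ^ (b1 \<phi> - 1)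
     \<and> (b1 \<phi> = 2 \<longrightarrow> (\<forall>s t. psl_order (T s t) \<in> {2, 4}))
     \<and> (b1 \<phi> = 3 \<longrightarrow> (\<forall>s t. psl_order (T s t) \<in> {1, 2}))"
  using assms
proof (cases rule: parity_patterns)
  case I_J
  then have "b1 \<phi> = 3"
    by (intro b1_eqI[where S = "{(False, False), (False, True), (True, False), (True, True)}"]) auto
  with I_J sign_conjugators_qI_qJ show ?thesis
    by (simp add: q8_def)
next
  case J_I
  then have "b1 \<phi> = 2"
    by (intro b1_eqI[where S = "{(False, False), (True, True)}"]) auto
  with J_I sign_conjugators_qJ_qI show ?thesis
    by (simp add: q8_def)
next
  case I_K
  then have "b1 \<phi> = 2"
    by (intro b1_eqI[where S = "{(False, False), (False, True)}"]) auto
  with I_K sign_conjugators_qI_qK show ?thesis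
    by (simp add: q8_def)
next
  case K_J
  then have "b1 \<phi> = 2"
    by (intro b1_eqI[where S = "{(False, False), (True, False)}"]) auto
  with K_J sign_conjugators_qK_qJ show ?thesis
    by (simp add: q8_def)
next
  case J_K
  then have "b1 \<phi> = 1"
    by (intro b1_eqI[where S = "{(False, False)}"]) auto
  with J_K sign_conjugators_qJ_qK show ?thesis
    by (simp add: q8_def)
next
  case K_I
  then have "b1 \<phi> = 1"
    by (intro b1_eqI[where S = "{(False, False)}"]) auto
  with K_I sign_conjugators_qK_qI show ?thesis
    by (simp add: q8_def)
qed

theorem lemma4p3:
  fixes \<phi> :: "sgen \<Rightarrow> sgen word" and \<sigma> :: "sgen \<Rightarrow> complex^2^2"
  assumes "hyperbolic_optb \<phi>"
    and "psl_rep_S \<sigma>"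
    and "irreducible_rep \<sigma>"
    and "card (psl_centraliser (rep_image \<sigma>)) = 4"
  shows "card (rbar_fibre \<phi> (pchar \<sigma>)) = 2 ^ (b1 \<phi> - 1)
    \<and> card {chi \<in> rbar_fibre \<phi> (pchar \<sigma>). lifts_to_X \<phi> chi} = 1
    \<and> (\<forall>\<rho>. psl_rep_M \<phi> \<rho> \<and> pchar \<rho> \<in> rbar_fibre \<phi> (pchar \<sigma>) \<longrightarrow>
          psl_eq (mat_eval \<rho> longitude) (mat 1)
        \<and> (b1 \<phi> = 2 \<longrightarrow> psl_order (\<rho> MT) \<in> {2, 4})
        \<and> (b1 \<phi> = 3 \<longrightarrow> psl_order (\<rho> MT) \<in> {1, 2}))"
proof -
  have \<sigma>: "pchar \<sigma> = pchar q8_rep"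
    using pchar_eq_q8_rep_if_card_psl_centraliser_4[OF assms(3,2,4)] .
  obtain T where T: "sign_conjugators (q8 (ab_parity \<phi> SA SA) (ab_parity \<phi> SA SB))
                                       (q8 (ab_parity \<phi> SB SA) (ab_parity \<phi> SB SB)) T"
    "card {pchar (bundle_rep (T s t)) | s t. True} = 2 ^ (b1 \<phi> - 1)"
    "b1 \<phi> = 2 \<longrightarrow> (\<forall>s t. psl_order (T s t) \<in> {2, 4})" "b1 \<phi> = 3 \<longrightarrow> (\<forall>s t. psl_order (T s t) \<in> {1, 2})"
    using sign_conjugators_of_parities assms(1) unfolding hyperbolic_optb_def by blast
  note fibre = psl_eq_mat_eval_q8_rep_image psl_eq_mat_eval_q8_rep_image T(1)
  obtain s t where "{chi \<in> rbar_fibre \<phi> (pchar q8_rep). lifts_to_X \<phi> chi} = {pchar (bundle_rep (T s t))}"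
    using lifts_to_X_rbar_fibre_q8_rep[OF fibre] by blast
  moreover have "psl_eq (mat_eval \<rho> longitude) (mat 1) \<and> (\<exists>s t. psl_order (\<rho> MT) = psl_order (T s t))"
    if "psl_rep_M \<phi> \<rho>" "pchar \<rho> \<in> rbar_fibre \<phi> (pchar q8_rep)" for \<rho>
    using that longitude_rbar_fibre_q8_rep psl_order_meridian_rbar_fibre_q8_rep[OF fibre]
    by (simp add: rbar_fibre_def)
  ultimately show ?thesis
    using rbar_fibre_q8_rep[OF fibre] T(2-4) unfolding \<sigma> by fastforce
qed

end
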